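(* Let $\mathcal{G}_{6,1}$ be the real Lie algebra with basis $x_1,\dots,x_6$ and nonzero brackets $[x_1,x_2]=x_5$, $[x_1,x_4]=x_6$, $[x_2,x_3]=x_6$. The set $\mathfrak{X}_{6,1}$ of all complex structures on $\mathcal{G}_{6,1}$ is a 12-dimensional submanifold of $\mathbb{R}^{36}$. Moreover every element of $\mathfrak{X}_{6,1}$ is equivalent to at least one of the following complex structures: the structure $$J=\mathrm{diag}\left(\begin{pmatrix}0&1\\-1&0\end{pmatrix},\begin{pmatrix}0&-1\\1&0\end{pmatrix},\begin{pmatrix}0&-1\\1&0\end{pmatrix}\right);$$ a structure $$J_\alpha=\begin{pmatrix}0&-\alpha&0&-\alpha&0&0\\1&0&1&\alpha&0&0\\\alpha-1&\alpha-1&\alpha&(\alpha+1)\alpha&0&0\\-\frac{\alpha-1}{\alpha}&0&-1&-\alpha&0&0\\0&0&0&0&0&-1\\0&0&0&0&1&0\end{pmatrix}\qquad(\alpha\in\mathbb{R},\ \alpha\neq0);$$ or one of the two structures $J''_0$, $J''_1$, where $$J''_\gamma=\begin{pmatrix}0&0&1&-\gamma&0&0\\0&0&0&-1&0&0\\-1&\gamma&0&0&0&0\\0&1&0&0&0&0\\0&0&0&0&0&-\frac12\\0&0&0&0&2&0\end{pmatrix}.$$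
   Context: Brackets of basis vectors not listed (and not obtained by antisymmetry) are zero. A complex structure on a real Lie algebra $\mathfrak{g}$ is a linear map $J:\mathfrak{g}\to\mathfrak{g}$ with $J^2=-1$ and $[JX,JY]-[X,Y]-J[JX,Y]-J[X,JY]=0$ for all $X,Y\in\mathfrak{g}$. $J$ is identified with its $6\times 6$ matrix $(\xi^k_j)$ ($k$ the row index, $j$ the column index) in the basis $(x_j)$, i.e. $Jx_j=\sum_k\xi^k_j x_k$; so the set of complex structures is a subset of $\mathbb{R}^{36}$. "Submanifold" means smooth ($C^\infty$) submanifold. $\mathrm{Aut}(\mathfrak{g})$ acts on complex structures by $J\mapsto\Phi^{-1}J\Phi$, and two complex structures are equivalent if they lie in the same orbit. $\mathrm{diag}$ denotes a block-diagonal matrix. *)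

theory Defs
  imports "HOL-Analysis.Analysis"
begin

section \<open>Smooth maps and submanifolds of Euclidean space\<close>

text \<open>
  Intended for open \<open>S\<close> only: \<open>at x\<close> is the unrestricted filter. In finite dimension, continuity
  of every directional derivative \<open>x \<mapsto> Df(x) v\<close> is continuity of \<open>x \<mapsto> Df(x)\<close>.
\<close>

primrec Ck_on :: "nat \<Rightarrow> 'a::euclidean_space set \<Rightarrow> ('a \<Rightarrow> 'b::euclidean_space) \<Rightarrow> bool" where
  "Ck_on 0 S f \<longleftrightarrow> continuous_on S f"
| "Ck_on (Suc k) S f \<longleftrightarrow>
     (\<forall>x\<in>S. f differentiable at x) \<and> (\<forall>v. Ck_on k S (\<lambda>x. frechet_derivative f (at x) v))"

definition smooth_map_on :: "'a::euclidean_space set \<Rightarrow> ('a \<Rightarrow> 'b::euclidean_space) \<Rightarrow> bool" where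
  "smooth_map_on S f \<longleftrightarrow> (\<forall>k. Ck_on k S f)"

definition diffeomorphism ::
  "'a::euclidean_space set \<Rightarrow> 'b::euclidean_space set \<Rightarrow> ('a \<Rightarrow> 'b) \<Rightarrow> ('b \<Rightarrow> 'a) \<Rightarrow> bool" where
  "diffeomorphism U V \<phi> \<psi> \<longleftrightarrow>
     homeomorphism U V \<phi> \<psi> \<and> smooth_map_on U \<phi> \<and> smooth_map_on V \<psi>"

text \<open>
  Embedded submanifold of the ambient Euclidean space, via slice charts; every chart has the same
  slice dimension \<open>d\<close>.
\<close>

definition smooth_submanifold :: "nat \<Rightarrow> 'a::euclidean_space set \<Rightarrow> bool" where
  "smooth_submanifold d M \<longleftrightarrow>
     (\<forall>p\<in>M. \<exists>U V (\<phi> :: 'a \<Rightarrow> 'a) \<psi> L.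
        open U \<and> open V \<and> p \<in> U \<and> diffeomorphism U V \<phi> \<psi> \<and>
        subspace L \<and> dim L = d \<and> \<phi> ` (M \<inter> U) = L \<inter> V)"


section \<open>Complex structures on real Lie algebras\<close>

text \<open>A real Lie algebra is a real vector space type together with a bracket on it.\<close>

definition lie_bracket :: "('a::real_vector \<Rightarrow> 'a \<Rightarrow> 'a) \<Rightarrow> bool" where
  "lie_bracket br \<longleftrightarrow>
     (\<forall>x. linear (br x)) \<and> (\<forall>y. linear (\<lambda>x. br x y)) \<and> (\<forall>x. br x x = 0) \<and>
     (\<forall>x y z. br x (br y z) + br y (br z x) + br z (br x y) = 0)"

definition complex_structure :: "('a::real_vector \<Rightarrow> 'a \<Rightarrow> 'a) \<Rightarrow> ('a \<Rightarrow> 'a) \<Rightarrow> bool" where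
  "complex_structure br J \<longleftrightarrow>
     linear J \<and> (\<forall>X. J (J X) = - X) \<and>
     (\<forall>X Y. br (J X) (J Y) - br X Y - J (br (J X) Y) - J (br X (J Y)) = 0)"

definition lie_automorphism :: "('a::real_vector \<Rightarrow> 'a \<Rightarrow> 'a) \<Rightarrow> ('a \<Rightarrow> 'a) \<Rightarrow> bool" where
  "lie_automorphism br \<Phi> \<longleftrightarrow>
     linear \<Phi> \<and> bij \<Phi> \<and> (\<forall>X Y. \<Phi> (br X Y) = br (\<Phi> X) (\<Phi> Y))"

definition equivalent_structures ::
  "('a::real_vector \<Rightarrow> 'a \<Rightarrow> 'a) \<Rightarrow> ('a \<Rightarrow> 'a) \<Rightarrow> ('a \<Rightarrow> 'a) \<Rightarrow> bool" where
  "equivalent_structures br J J' \<longleftrightarrow>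
     (\<exists>\<Phi>. lie_automorphism br \<Phi> \<and> J' = inv \<Phi> \<circ> J \<circ> \<Phi>)"


section \<open>The Lie algebra with brackets $[x_1,x_2]=x_5$, $[x_1,x_4]=[x_2,x_3]=x_6$\<close>

text \<open>
  The basis is the standard one, \<open>x\<^sub>j = axis j 1\<close>. In the index type \<open>6\<close> the numeral \<open>6\<close>
  equals \<open>0\<close>, so the indices are exactly \<open>1, \<dots>, 6\<close>.
\<close>

definition br61 :: "real^6 \<Rightarrow> real^6 \<Rightarrow> real^6" where
  "br61 X Y =
     (X$1 * Y$2 - X$2 * Y$1) *\<^sub>R axis 5 1 +
     (X$1 * Y$4 - X$4 * Y$1 + X$2 * Y$3 - X$3 * Y$2) *\<^sub>R axis 6 1"

lemma lie_bracket_br61: "lie_bracket br61"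
  unfolding lie_bracket_def br61_def
  by (auto intro!: linearI simp: axis_def vec_eq_iff algebra_simps)

lemma br61_basis:
  fixes x :: "6 \<Rightarrow> real^6"
  assumes "\<And>j. x j = axis j 1"
  shows "br61 (x 1) (x 2) = x 5" "br61 (x 1) (x 4) = x 6" "br61 (x 2) (x 3) = x 6"
    and "\<And>i j. (i, j) \<notin> {(1,2), (2,1), (1,4), (4,1), (2,3), (3,2)} \<Longrightarrow> br61 (x i) (x j) = 0"
  by (auto simp: assms br61_def axis_def)

text \<open>Complex structures as matrices, \<open>A $ k $ j\<close> being the coefficient of \<open>x\<^sub>k\<close> in \<open>J x\<^sub>j\<close>.\<close>

definition X61 :: "(real^6^6) set" where
  "X61 = {A. complex_structure br61 ((*v) A)}"

definition equiv61 :: "real^6^6 \<Rightarrow> real^6^6 \<Rightarrow> bool" where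
  "equiv61 A B \<longleftrightarrow> equivalent_structures br61 ((*v) A) ((*v) B)"

definition J61_diag :: "real^6^6" where
  "J61_diag = vector
    [vector [ 0, 1,  0,  0,  0,  0],
     vector [-1, 0,  0,  0,  0,  0],
     vector [ 0, 0,  0, -1,  0,  0],
     vector [ 0, 0,  1,  0,  0,  0],
     vector [ 0, 0,  0,  0,  0, -1],
     vector [ 0, 0,  0,  0,  1,  0]]"

definition J61 :: "real \<Rightarrow> real^6^6" where
  "J61 \<alpha> = vector
    [vector [0, - \<alpha>, 0, - \<alpha>, 0, 0],
     vector [1, 0, 1, \<alpha>, 0, 0],
     vector [\<alpha> - 1, \<alpha> - 1, \<alpha>, (\<alpha> + 1) * \<alpha>, 0, 0],
     vector [- ((\<alpha> - 1) / \<alpha>), 0, -1, - \<alpha>, 0, 0],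
     vector [0, 0, 0, 0, 0, -1],
     vector [0, 0, 0, 0, 1, 0]]"

definition J61'' :: "real \<Rightarrow> real^6^6" where
  "J61'' \<gamma> = vector
    [vector [ 0, 0, 1, - \<gamma>, 0, 0],
     vector [ 0, 0, 0, -1, 0, 0],
     vector [-1, \<gamma>, 0,  0, 0, 0],
     vector [ 0, 1, 0,  0, 0, 0],
     vector [ 0, 0, 0,  0, 0, - 1 / 2],
     vector [ 0, 0, 0,  0, 2, 0]]"

end

theory Submission
  imports Defs
begin

text \<open>
  A complex structure \<open>J\<close> preserves the centre \<open>\<langle>x\<^sub>5, x\<^sub>6\<rangle>\<close>. Since the Nijenhuis tensor is determined by its value on
  one pair \<open>u, v\<close> with \<open>u, v, Ju, Jv\<close> independent modulo the centre, \<open>J\<close> is given by \<open>Ju\<close>, \<open>Jv\<close> and the restriction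
  to the centre, subject to two equations that are affine in \<open>Ju\<close>. These equations are independent
  everywhere, so the set of complex structures is locally the graph of a rational map in 12 of the
  36 matrix entries.

  For the classification let \<open>W = \<langle>x\<^sub>3, \<dots>, x\<^sub>6\<rangle>\<close>. If \<open>J W = W\<close> then \<open>J\<close> is abelian, i.e.
  \<open>[JX, JY] = [X, Y]\<close>, and is equivalent to the diagonal model. Otherwise the \<open>x\<^sub>6\<close>-component of \<open>[w, J w']\<close>
  is a nondegenerate, nonsymmetric bilinear form on \<open>W\<close> modulo the centre; integrability makes its
  congruence class up to scale the only invariant. If the form is alternating one finds \<open>J''\<^sub>0\<close>, otherwise a basis
  in which its matrix is a multiple of \<open>(1, \<alpha>; 0, -\<alpha>)\<close>, which is the form of \<open>J\<^sub>\<alpha>\<close>.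
\<close>

section \<open>The index type\<close>

lemma exhaust_6:
  fixes x :: 6
  shows "x = 1 \<or> x = 2 \<or> x = 3 \<or> x = 4 \<or> x = 5 \<or> x = 6"
proof (induct x)
  case (of_int z)
  then have "0 \<le> z" and "z < 6" by simp_all
  then have "z = 0 \<or> z = 1 \<or> z = 2 \<or> z = 3 \<or> z = 4 \<or> z = 5" by arith
  then show ?case by auto
qed

lemma forall_6: "(\<forall>i::6. P i) \<longleftrightarrow> P 1 \<and> P 2 \<and> P 3 \<and> P 4 \<and> P 5 \<and> P 6"
  by (metis exhaust_6)

lemma UNIV_6: "UNIV = {1, 2, 3, 4, 5, 6::6}"
  using exhaust_6 by auto

lemma sum_6: "sum f (UNIV::6 set) = f 1 + f 2 + f 3 + f 4 + f 5 + f 6"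
  unfolding UNIV_6 by (simp add: ac_simps)

lemma vector_6:
  "(vector [a,b,c,d,e,f] :: 'a::zero^6) $ 1 = a"
  "(vector [a,b,c,d,e,f] :: 'a::zero^6) $ 2 = b"
  "(vector [a,b,c,d,e,f] :: 'a::zero^6) $ 3 = c"
  "(vector [a,b,c,d,e,f] :: 'a::zero^6) $ 4 = d"
  "(vector [a,b,c,d,e,f] :: 'a::zero^6) $ 5 = e"
  "(vector [a,b,c,d,e,f] :: 'a::zero^6) $ 6 = f"
  by (simp_all add: vector_def)

section \<open>Smooth maps\<close>

lemma Ck_on_SucD: "Ck_on (Suc k) S f \<Longrightarrow> Ck_on k S f"
proof (induction k arbitrary: f)
  case 0
  then show ?case
    by (auto intro!: continuous_at_imp_continuous_on differentiable_imp_continuous_within)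
next
  case (Suc k)
  from Suc.prems show ?case
    by (auto intro: Suc.IH)
qed

text \<open>On an open set the derivative at a point depends only on nearby values, so
  \<open>frechet_derivative\<close> is the same for \<open>f\<close> and \<open>g\<close>, and the
  induction passes to directional derivatives.\<close>

lemma Ck_on_cong:
  assumes "open S" "\<And>x. x \<in> S \<Longrightarrow> f x = g x" "Ck_on k S f"
  shows "Ck_on k S g"
  using assms(2,3)
proof (induction k arbitrary: f g)
  case 0
  then show ?case by (metis Ck_on.simps(1) continuous_on_cong)
next
  case (Suc k)
  have D: "(g has_derivative frechet_derivative f (at x)) (at x)" if "x \<in> S" for x
  proof -
    have "(f has_derivative frechet_derivative f (at x)) (at x)"
      using Suc.prems that by (simp add: frechet_derivative_works[symmetric])
    then show ?thesis
      using has_derivative_transform_within_open[OF _ assms(1) that] Suc.prems(1) by blast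
  qed
  have "frechet_derivative g (at x) = frechet_derivative f (at x)" if "x \<in> S" for x
    using frechet_derivative_at[OF D[OF that]] by simp
  then have "Ck_on k S (\<lambda>x. frechet_derivative g (at x) v)" for v
    using Suc.IH[of "\<lambda>x. frechet_derivative f (at x) v"] Suc.prems by simp
  moreover have "g differentiable at x" if "x \<in> S" for x
    using D[OF that] differentiableI by blast
  ultimately show ?case by simp
qed

text \<open>By uniqueness of derivatives an explicit \<open>f'\<close> can replace the
  choice-defined \<open>frechet_derivative\<close>; the closure properties below rest on
  this.\<close>

lemma Ck_on_SucI:
  assumes "open S" "\<And>x. x \<in> S \<Longrightarrow> (f has_derivative f' x) (at x)"
    "\<And>v. Ck_on k S (\<lambda>x. f' x v)"
  shows "Ck_on (Suc k) S f"
proof -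
  have "f' x = frechet_derivative f (at x)" if "x \<in> S" for x
    using frechet_derivative_at[OF assms(2)[OF that]] .
  then have "Ck_on k S (\<lambda>x. frechet_derivative f (at x) v)" for v
    using Ck_on_cong[OF assms(1) _ assms(3)[of v]] by simp
  then show ?thesis
    using assms(2) by (auto simp: differentiable_def)
qed

lemma Ck_on_Suc_derivative:
  "Ck_on (Suc k) S f \<Longrightarrow> x \<in> S \<Longrightarrow> (f has_derivative frechet_derivative f (at x)) (at x)"
  by (simp add: frechet_derivative_works[symmetric])

lemma Ck_on_const: "open S \<Longrightarrow> Ck_on k S (\<lambda>x. c)"
proof (induction k arbitrary: c)
  case (Suc k)
  then show ?case by (intro Ck_on_SucI) (auto intro: has_derivative_const)
qed simp

lemma Ck_on_bounded_linear:
  assumes "open S" "bounded_linear T"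
  shows "Ck_on k S T"
proof (cases k)
  case 0
  then show ?thesis using assms by (simp add: linear_continuous_on)
next
  case (Suc k')
  then show ?thesis
    using assms Ck_on_SucI[OF assms(1), of T "\<lambda>x. T"] Ck_on_const[OF assms(1)]
    by (auto intro: bounded_linear_imp_has_derivative)
qed

lemma Ck_on_compose_linear:
  assumes "open S" "bounded_linear T" "Ck_on k S f"
  shows "Ck_on k S (\<lambda>x. T (f x))"
  using assms(3)
proof (induction k arbitrary: f)
  case 0
  then show ?case
    using assms(2) by (simp add: bounded_linear.continuous_on)
next
  case (Suc k)
  show ?case
  proof (rule Ck_on_SucI[OF assms(1)])
    show "((\<lambda>x. T (f x)) has_derivative (\<lambda>v. T (frechet_derivative f (at x) v))) (at x)"
      if "x \<in> S" for x
      using bounded_linear.has_derivative[OF assms(2) Ck_on_Suc_derivative[OF Suc.prems that]] .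
    show "Ck_on k S (\<lambda>x. T (frechet_derivative f (at x) v))" for v
      using Suc.IH Suc.prems by simp
  qed
qed

lemma Ck_on_add:
  assumes "open S" "Ck_on k S f" "Ck_on k S g"
  shows "Ck_on k S (\<lambda>x. f x + g x)"
  using assms(2,3)
proof (induction k arbitrary: f g)
  case 0
  then show ?case by (simp add: continuous_on_add)
next
  case (Suc k)
  show ?case
  proof (rule Ck_on_SucI[OF assms(1)])
    show "((\<lambda>x. f x + g x) has_derivative
        (\<lambda>v. frechet_derivative f (at x) v + frechet_derivative g (at x) v)) (at x)"
      if "x \<in> S" for x
      using Ck_on_Suc_derivative[OF Suc.prems(1) that] Ck_on_Suc_derivative[OF Suc.prems(2) that]
      by (rule has_derivative_add)
    show "Ck_on k S (\<lambda>x. frechet_derivative f (at x) v + frechet_derivative g (at x) v)" for v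
      using Suc.IH Suc.prems by simp
  qed
qed

lemma Ck_on_mult:
  fixes f g :: "'a::euclidean_space \<Rightarrow> real"
  assumes "open S" "Ck_on k S f" "Ck_on k S g"
  shows "Ck_on k S (\<lambda>x. f x * g x)"
  using assms(2,3)
proof (induction k arbitrary: f g)
  case 0
  then show ?case by (simp add: continuous_on_mult)
next
  case (Suc k)
  show ?case
  proof (rule Ck_on_SucI[OF assms(1)])
    show "((\<lambda>x. f x * g x) has_derivative
        (\<lambda>v. f x * frechet_derivative g (at x) v + frechet_derivative f (at x) v * g x)) (at x)"
      if "x \<in> S" for x
      using Ck_on_Suc_derivative[OF Suc.prems(1) that] Ck_on_Suc_derivative[OF Suc.prems(2) that]
      by (rule has_derivative_mult)
    show "Ck_on k S (\<lambda>x. f x * frechet_derivative g (at x) v + frechet_derivative f (at x) v * g x)"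
      for v
      using Suc.IH Suc.prems Ck_on_SucD[OF Suc.prems(1)] Ck_on_SucD[OF Suc.prems(2)]
      by (intro Ck_on_add assms(1)) auto
  qed
qed

text \<open>The derivative of 1/f contains 1/f again, but only to order \<open>k\<close>, which is
  the induction hypothesis for the same \<open>f\<close>.\<close>

lemma Ck_on_inverse:
  fixes f :: "'a::euclidean_space \<Rightarrow> real"
  assumes "open S" "Ck_on k S f" "\<And>x. x \<in> S \<Longrightarrow> f x \<noteq> 0"
  shows "Ck_on k S (\<lambda>x. inverse (f x))"
  using assms(2)
proof (induction k)
  case 0
  then show ?case using assms(3) by (auto intro!: continuous_on_inverse)
next
  case (Suc k)
  have IH: "Ck_on k S (\<lambda>x. inverse (f x))"
    using Suc Ck_on_SucD by blast
  show ?case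
  proof (rule Ck_on_SucI[OF assms(1)])
    show "((\<lambda>x. inverse (f x)) has_derivative
        (\<lambda>v. - (inverse (f x) * frechet_derivative f (at x) v * inverse (f x)))) (at x)"
      if "x \<in> S" for x
      using Ck_on_Suc_derivative[OF Suc.prems that] assms(3)[OF that]
      by (auto intro!: derivative_eq_intros simp: power2_eq_square)
    have "Ck_on k S (\<lambda>x. inverse (f x) * frechet_derivative f (at x) v * inverse (f x))" for v
      using IH Suc.prems by (intro Ck_on_mult assms(1)) auto
    then show "Ck_on k S (\<lambda>x. - (inverse (f x) * frechet_derivative f (at x) v * inverse (f x)))" for v
      using Ck_on_compose_linear[OF assms(1) bounded_linear_minus[OF bounded_linear_ident]] by blast
  qed
qed

lemma smooth_map_on_cong:
  "smooth_map_on S f \<Longrightarrow> open S \<Longrightarrow> (\<And>x. x \<in> S \<Longrightarrow> f x = g x) \<Longrightarrow> smooth_map_on S g"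
  unfolding smooth_map_on_def by (meson Ck_on_cong)

lemma smooth_map_on_imp_continuous_on: "smooth_map_on S f \<Longrightarrow> continuous_on S f"
  unfolding smooth_map_on_def using Ck_on.simps(1) by blast

lemma smooth_map_on_const: "open S \<Longrightarrow> smooth_map_on S (\<lambda>x. c)"
  unfolding smooth_map_on_def using Ck_on_const by blast

lemma smooth_map_on_linear: "open S \<Longrightarrow> bounded_linear T \<Longrightarrow> smooth_map_on S T"
  unfolding smooth_map_on_def using Ck_on_bounded_linear by blast

lemma smooth_map_on_compose_linear:
  "open S \<Longrightarrow> bounded_linear T \<Longrightarrow> smooth_map_on S f \<Longrightarrow> smooth_map_on S (\<lambda>x. T (f x))"
  unfolding smooth_map_on_def using Ck_on_compose_linear by blast

lemma smooth_map_on_add: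
  "open S \<Longrightarrow> smooth_map_on S f \<Longrightarrow> smooth_map_on S g \<Longrightarrow> smooth_map_on S (\<lambda>x. f x + g x)"
  unfolding smooth_map_on_def using Ck_on_add by blast

lemma smooth_map_on_minus:
  "open S \<Longrightarrow> smooth_map_on S f \<Longrightarrow> smooth_map_on S (\<lambda>x. - f x)"
  using smooth_map_on_compose_linear[OF _ bounded_linear_minus[OF bounded_linear_ident]] .

lemma smooth_map_on_diff:
  "open S \<Longrightarrow> smooth_map_on S f \<Longrightarrow> smooth_map_on S g \<Longrightarrow> smooth_map_on S (\<lambda>x. f x - g x)"
  using smooth_map_on_add[of S f "\<lambda>x. - g x"] smooth_map_on_minus[of S g] by simp

lemma smooth_map_on_mult:
  fixes f g :: "'a::euclidean_space \<Rightarrow> real"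
  shows "open S \<Longrightarrow> smooth_map_on S f \<Longrightarrow> smooth_map_on S g \<Longrightarrow> smooth_map_on S (\<lambda>x. f x * g x)"
  unfolding smooth_map_on_def using Ck_on_mult by blast

lemma smooth_map_on_divide:
  fixes f g :: "'a::euclidean_space \<Rightarrow> real"
  assumes "open S" "smooth_map_on S f" "smooth_map_on S g" "\<And>x. x \<in> S \<Longrightarrow> g x \<noteq> 0"
  shows "smooth_map_on S (\<lambda>x. f x / g x)"
proof -
  have "smooth_map_on S (\<lambda>x. inverse (g x))"
    using assms Ck_on_inverse unfolding smooth_map_on_def by blast
  then show ?thesis
    using smooth_map_on_mult[OF assms(1,2)] by (simp add: divide_inverse)
qed

lemma smooth_map_on_sum:
  assumes "open S" "\<And>i. i \<in> I \<Longrightarrow> smooth_map_on S (f i)"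
  shows "smooth_map_on S (\<lambda>x. \<Sum>i\<in>I. f i x)"
  using assms(2)
  by (induction I rule: infinite_finite_induct)
    (auto intro!: smooth_map_on_const[OF assms(1)] smooth_map_on_add[OF assms(1)])

lemma smooth_map_on_prod:
  fixes f :: "'i \<Rightarrow> 'a::euclidean_space \<Rightarrow> real"
  assumes "open S" "\<And>i. i \<in> I \<Longrightarrow> smooth_map_on S (f i)"
  shows "smooth_map_on S (\<lambda>x. \<Prod>i\<in>I. f i x)"
  using assms(2)
  by (induction I rule: infinite_finite_induct)
    (auto intro!: smooth_map_on_const[OF assms(1)] smooth_map_on_mult[OF assms(1)])

lemma smooth_map_on_nth:
  fixes f :: "'a::euclidean_space \<Rightarrow> 'b::euclidean_space^'n"
  shows "open S \<Longrightarrow> smooth_map_on S f \<Longrightarrow> smooth_map_on S (\<lambda>x. f x $ i)"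
  using smooth_map_on_compose_linear[OF _ bounded_linear_vec_nth] .

lemma bounded_linear_axis: "bounded_linear (axis i :: 'b::euclidean_space \<Rightarrow> 'b^'n)"
  unfolding linear_conv_bounded_linear[symmetric]
  by (rule linearI) (auto simp: axis_def vec_eq_iff)

lemma smooth_map_on_vecI:
  fixes f :: "'a::euclidean_space \<Rightarrow> 'b::euclidean_space^'n"
  assumes "open S" "\<And>i. smooth_map_on S (\<lambda>x. f x $ i)"
  shows "smooth_map_on S f"
proof -
  have "smooth_map_on S (\<lambda>x. \<Sum>i\<in>UNIV. axis i (f x $ i))"
    using assms
    by (intro smooth_map_on_sum smooth_map_on_compose_linear[OF _ bounded_linear_axis])
  moreover have "(\<Sum>i\<in>UNIV. axis i (f x $ i)) = f x" for x
    by (simp add: vec_eq_iff axis_def sum.delta if_distrib cong: if_cong)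
  ultimately show ?thesis by simp
qed

section \<open>Smoothness of determinants, matrix products and inverses\<close>

lemma smooth_map_on_det:
  fixes f :: "'a::euclidean_space \<Rightarrow> real^'n^'n"
  assumes "open S" "smooth_map_on S f"
  shows "smooth_map_on S (\<lambda>x. det (f x))"
  unfolding det_def
  by (intro smooth_map_on_sum[OF assms(1)] smooth_map_on_mult[OF assms(1)]
      smooth_map_on_prod[OF assms(1)] smooth_map_on_const[OF assms(1)])
    (rule smooth_map_on_nth[OF assms(1) smooth_map_on_nth[OF assms]])

lemma smooth_map_on_matrix_mult:
  fixes f g :: "'a::euclidean_space \<Rightarrow> real^'n^'n"
  assumes "open S" "smooth_map_on S f" "smooth_map_on S g"
  shows "smooth_map_on S (\<lambda>x. f x ** g x)"
proof (rule smooth_map_on_vecI[OF assms(1)], rule smooth_map_on_vecI[OF assms(1)])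
  fix i j
  have "smooth_map_on S (\<lambda>x. \<Sum>k\<in>UNIV. f x $ i $ k * g x $ k $ j)"
    using smooth_map_on_nth[OF assms(1) smooth_map_on_nth[OF assms(1)]] assms(2,3)
    by (intro smooth_map_on_sum[OF assms(1)] smooth_map_on_mult[OF assms(1)]) blast+
  then show "smooth_map_on S (\<lambda>x. (f x ** g x) $ i $ j)"
    by (simp add: matrix_matrix_mult_def)
qed

lemma matrix_inv_inverse:
  fixes A :: "'a::semiring_1^'n^'m"
  assumes "invertible A"
  shows "A ** matrix_inv A = mat 1" "matrix_inv A ** A = mat 1"
  using someI_ex[OF assms[unfolded invertible_def]] by (simp_all add: matrix_inv_def)

text \<open>Cramer's rule on basis vectors turns the entries of the inverse into quotients of
  determinants, which are visibly smooth.\<close>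

lemma matrix_inv_cramer:
  fixes A :: "real^'n^'n"
  assumes "det A \<noteq> 0"
  shows "matrix_inv A $ k $ l =
    det (\<chi> i j. if j = k then axis l 1 $ i else A $ i $ j) / det A"
proof -
  have "A *v (matrix_inv A *v axis l 1) = axis l 1"
    using assms by (simp add: invertible_det_nz matrix_vector_mul_assoc matrix_inv_inverse)
  then have "matrix_inv A *v axis l 1 =
      (\<chi> k. det (\<chi> i j. if j = k then axis l 1 $ i else A $ i $ j) / det A)"
    using cramer[OF assms] by blast
  moreover have "(matrix_inv A *v axis l 1) $ k = matrix_inv A $ k $ l"
    by (simp add: matrix_vector_mult_basis column_def)
  ultimately show ?thesis by simp
qed

lemma smooth_map_on_matrix_inv:
  fixes f :: "'a::euclidean_space \<Rightarrow> real^'n^'n"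
  assumes "open S" "smooth_map_on S f" "\<And>x. x \<in> S \<Longrightarrow> det (f x) \<noteq> 0"
  shows "smooth_map_on S (\<lambda>x. matrix_inv (f x))"
proof (rule smooth_map_on_vecI[OF assms(1)], rule smooth_map_on_vecI[OF assms(1)])
  fix k l
  let ?g = "\<lambda>x. \<chi> i j. if j = k then axis l 1 $ i else f x $ i $ j"
  have "smooth_map_on S (\<lambda>x. ?g x $ i $ j)" for i j
    using smooth_map_on_const[OF assms(1)] smooth_map_on_nth[OF assms(1) smooth_map_on_nth[OF assms(1,2)]]
    by (cases "j = k") auto
  then have "smooth_map_on S ?g"
    by (rule smooth_map_on_vecI[OF assms(1) smooth_map_on_vecI[OF assms(1)]])
  then have "smooth_map_on S (\<lambda>x. det (?g x) / det (f x))"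
    using assms by (intro smooth_map_on_divide smooth_map_on_det)
  then show "smooth_map_on S (\<lambda>x. matrix_inv (f x) $ k $ l)"
    using assms by (auto intro: smooth_map_on_cong simp: matrix_inv_cramer)
qed

text \<open>The witnessing chart \<open>x \<mapsto> x - (G x - \<pi> x)\<close> straightens the graph of \<open>G\<close> over \<open>range \<pi>\<close>.\<close>

lemma graph_slice_chart:
  fixes \<pi> G :: "'a::euclidean_space \<Rightarrow> 'a"
  assumes "linear \<pi>" "\<And>x. \<pi> (\<pi> x) = \<pi> x" "open U" "\<And>x. \<pi> x \<in> U \<longleftrightarrow> x \<in> U"
    and "smooth_map_on U G" "\<And>x. G (\<pi> x) = G x" "\<And>x. x \<in> U \<Longrightarrow> \<pi> (G x) = \<pi> x"
    and M: "\<And>x. x \<in> U \<Longrightarrow> x \<in> M \<longleftrightarrow> x = G x"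
    and "p \<in> U"
  shows "\<exists>U V (\<phi> :: 'a \<Rightarrow> 'a) \<psi> L.
        open U \<and> open V \<and> p \<in> U \<and> diffeomorphism U V \<phi> \<psi> \<and>
        subspace L \<and> dim L = dim (range \<pi>) \<and> \<phi> ` (M \<inter> U) = L \<inter> V"
proof -
  define F where "F x = G x - \<pi> x" for x
  have pF: "\<pi> (F x) = 0" if "x \<in> U" for x
    using assms(1) assms(2,7)[of x] that by (simp add: F_def linear_diff)
  have bl: "bounded_linear \<pi>" using assms(1) linear_conv_bounded_linear by blast
  have sF: "smooth_map_on U F"
    unfolding F_def
    by (rule smooth_map_on_diff[OF assms(3,5) smooth_map_on_linear[OF assms(3) bl]])
  have F\<pi>: "F (\<pi> x) = F x" for x using assms(2,6) by (simp add: F_def)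
  \<comment> \<open>On \<open>U\<close> the values of \<open>F\<close> lie in the kernel of \<pi>,
    and \<open>F x\<close> depends only on \<pi> x; so the shears by \<open>- F\<close> and
    \<open>F\<close> preserve \<open>U\<close> and invert each other.\<close>
  have p1: "\<pi> (x - F x) = \<pi> x" "\<pi> (x + F x) = \<pi> x" if "x \<in> U" for x
    using pF[OF that] assms(1) by (simp_all add: linear_diff linear_add)
  have F1: "F (x - F x) = F x" "F (x + F x) = F x" if "x \<in> U" for x
    using F\<pi> p1[OF that] by metis+
  have U1: "x - F x \<in> U" "x + F x \<in> U" if "x \<in> U" for x
    using assms(4) p1[OF that] that by metis+
  have sm: "smooth_map_on U (\<lambda>x. x - F x)" "smooth_map_on U (\<lambda>x. x + F x)"
    using smooth_map_on_linear[OF assms(3) bounded_linear_ident] sF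
    by (simp_all add: smooth_map_on_diff[OF assms(3)] smooth_map_on_add[OF assms(3)])
  have "diffeomorphism U U (\<lambda>x. x - F x) (\<lambda>x. x + F x)"
    unfolding diffeomorphism_def
  proof (intro conjI homeomorphismI sm smooth_map_on_imp_continuous_on)
    show "(\<lambda>x. x - F x) ` U \<subseteq> U" "(\<lambda>x. x + F x) ` U \<subseteq> U"
      using U1 by blast+
    show "x - F x + F (x - F x) = x" "x + F x - F (x + F x) = x" if "x \<in> U" for x
      using F1[OF that] by (simp_all only: diff_add_cancel add_diff_cancel_right')
  qed
  moreover have "(\<lambda>x. x - F x) ` (M \<inter> U) = range \<pi> \<inter> U"
  proof (intro equalityI subsetI)
    fix y assume "y \<in> (\<lambda>x. x - F x) ` (M \<inter> U)"
    then obtain x where x: "x \<in> M" "x \<in> U" "y = x - F x" by blast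
    have "G x = x" using M[OF x(2)] x(1) by (rule sym[OF iffD1])
    then have "y = \<pi> x" by (simp add: F_def x(3))
    moreover have "\<pi> x \<in> U" using assms(4) x(2) by simp
    ultimately show "y \<in> range \<pi> \<inter> U" by simp
  next
    fix y assume "y \<in> range \<pi> \<inter> U"
    then have y: "y \<in> U" "\<pi> y = y" using assms(2) by auto
    then have e: "y + F y = G y" by (simp add: F_def)
    \<comment> \<open>\<open>y + F y\<close> has the same projection as \<open>y\<close>, and
      \<open>G\<close> sees only the projection.\<close>
    have "G (y + F y) = G y" using p1(2)[OF y(1)] assms(6) by metis
    then have "y + F y = G (y + F y)" by (simp only: e)
    then have "y + F y \<in> M" by (rule iffD2[OF M[OF U1(2)[OF y(1)]]])
    moreover have "y = (y + F y) - F (y + F y)" using F1(2)[OF y(1)] by simp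
    ultimately show "y \<in> (\<lambda>x. x - F x) ` (M \<inter> U)"
      by (intro image_eqI[where x = "y + F y"] IntI U1(2)[OF y(1)])
  qed
  moreover have "subspace (range \<pi>)"
    using assms(1) linear_subspace_image subspace_UNIV by blast
  ultimately show ?thesis using assms(3,9) by blast
qed

section \<open>The bracket and the centre\<close>

lemma axis_6:
  "(axis i x :: 'a::zero^6) $ j = (if j = i then x else 0)"
  by (simp add: axis_def)

lemma br61_nth [simp]:
  "br61 X Y $ 1 = 0" "br61 X Y $ 2 = 0" "br61 X Y $ 3 = 0" "br61 X Y $ 4 = 0"
  "br61 X Y $ 5 = X$1 * Y$2 - X$2 * Y$1"
  "br61 X Y $ 6 = X$1 * Y$4 - X$4 * Y$1 + X$2 * Y$3 - X$3 * Y$2"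
  by (simp_all add: br61_def axis_def)

lemmas vec6_eq_iff = vec_eq_iff[where 'b = 6, unfolded forall_6]

lemma br61_add_left: "br61 (X + Y) Z = br61 X Z + br61 Y Z"
  and br61_add_right: "br61 Z (X + Y) = br61 Z X + br61 Z Y"
  and br61_scaleR_left: "br61 (r *\<^sub>R X) Y = r *\<^sub>R br61 X Y"
  and br61_scaleR_right: "br61 X (r *\<^sub>R Y) = r *\<^sub>R br61 X Y"
  and br61_minus_left: "br61 (- X) Y = - br61 X Y"
  and br61_minus_right: "br61 X (- Y) = - br61 X Y"
  and br61_skew: "br61 X Y = - br61 Y X"
  by (simp_all add: vec6_eq_iff algebra_simps)

lemma br61_self [simp]: "br61 X X = 0"
  by (simp add: vec6_eq_iff)

definition centre61 :: "(real^6) set" where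
  "centre61 = {Z. Z$1 = 0 \<and> Z$2 = 0 \<and> Z$3 = 0 \<and> Z$4 = 0}"

lemma br61_in_centre [simp]: "br61 X Y \<in> centre61"
  by (simp add: centre61_def)

lemma br61_centre [simp]:
  "Z \<in> centre61 \<Longrightarrow> br61 Z X = 0" "Z \<in> centre61 \<Longrightarrow> br61 X Z = 0"
  by (simp_all add: centre61_def vec6_eq_iff)

lemma subspace_centre61: "subspace centre61"
  by (auto simp: subspace_def centre61_def)

lemma centre61_axis [simp]: "axis 5 r \<in> centre61" "axis 6 r \<in> centre61"
  by (simp_all add: centre61_def axis_def)

lemma centre61_decomp:
  "Z \<in> centre61 \<Longrightarrow> Z = Z$5 *\<^sub>R axis 5 1 + Z$6 *\<^sub>R axis 6 1"
  by (simp add: vec6_eq_iff axis_def centre61_def)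

lemma in_centre61_if_commutes:
  assumes "\<And>Y. br61 X Y = 0"
  shows "X \<in> centre61"
  using assms[of "axis 1 1"] assms[of "axis 2 1"] assms[of "axis 3 1"] assms[of "axis 4 1"]
  by (simp add: vec6_eq_iff axis_def centre61_def)

subsection \<open>Complex structures preserve the centre\<close>

locale cs61 =
  fixes A :: "real^6^6"
  assumes A: "A \<in> X61"
begin

abbreviation J :: "real^6 \<Rightarrow> real^6" where "J \<equiv> (*v) A"

lemma J_J [simp]: "A *v (A *v X) = - X"
  and integrable: "br61 (J X) (J Y) - br61 X Y - J (br61 (J X) Y) - J (br61 X (J Y)) = 0"
  using A unfolding X61_def complex_structure_def by auto

lemma J_minus: "J (- X) = - J X"
  by (metis add.inverse_inverse J_J)

text \<open>
  If \<open>J Z\<close> were not central, the image of \<open>ad (J Z)\<close> would be a nonzero \<open>J\<close>-invariant subspace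
  of the two-dimensional centre, hence all of it.
\<close>

lemma J_centre:
  assumes Z: "Z \<in> centre61"
  shows "J Z \<in> centre61"
proof (rule ccontr)
  assume "J Z \<notin> centre61"
  then obtain Y where Y: "br61 (J Z) Y \<noteq> 0"
    using in_centre61_if_commutes by blast
  define E where "E = br61 (J Z) Y"
  \<comment> \<open>Integrability at \<open>(Z, Y)\<close>: the terms in which \<open>Z\<close>
    itself is bracketed vanish.\<close>
  have JE: "J E = br61 (J Z) (J Y)"
    using integrable[of Z Y] Z by (simp add: E_def)
  have EJE: "E \<in> centre61" "J E \<in> centre61" "E \<noteq> 0"
    using Y by (simp_all add: JE) (simp_all add: E_def)
  \<comment> \<open>The determinant of \<open>E\<close>, \<open>J E\<close> in the basis
    \<open>x\<^sub>5, x\<^sub>6\<close>. Were it zero, \<open>E\<close> would be an eigenvector of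
    \<open>J\<close> with a real eigenvalue of square -1.\<close>
  define d where "d = E$5 * (J E)$6 - E$6 * (J E)$5"
  have "d \<noteq> 0"
  proof
    assume d: "d = 0"
    have "\<exists>r. J E = r *\<^sub>R E"
    proof (cases "E$5 = 0")
      case True
      then have "E$6 \<noteq> 0" using EJE by (auto simp: vec6_eq_iff centre61_def)
      then have "J E = ((J E)$6 / E$6) *\<^sub>R E"
        using True d EJE by (auto simp: vec6_eq_iff centre61_def d_def)
      then show ?thesis by blast
    next
      case False
      then have "J E = ((J E)$5 / E$5) *\<^sub>R E"
        using d EJE by (auto simp: vec6_eq_iff centre61_def d_def field_simps)
      then show ?thesis by blast
    qed
    then obtain r where r: "J E = r *\<^sub>R E" by blast
    have "- E = (r * r) *\<^sub>R E"
      using J_J[of E] by (simp add: r matrix_vector_mult_scaleR)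
    then have "(r * r + 1) *\<^sub>R E = 0" by (simp add: scaleR_add_left) (metis neg_eq_iff_add_eq_0 add.commute)
    moreover have "r * r + 1 > 0" by (simp add: add_nonneg_pos)
    ultimately show False using EJE by simp
  qed
  \<comment> \<open>Cramer's rule for the coefficients of \<open>Z\<close> in the basis
    \<open>E\<close>, \<open>J E\<close> of the centre.\<close>
  define r where "r = (Z$5 * (J E)$6 - Z$6 * (J E)$5) / d"
  define s where "s = (E$5 * Z$6 - E$6 * Z$5) / d"
  have "d * r = Z$5 * (J E)$6 - Z$6 * (J E)$5" "d * s = E$5 * Z$6 - E$6 * Z$5"
    using \<open>d \<noteq> 0\<close> by (simp_all add: r_def s_def)
  then have "d * (r * E$5 + s * (J E)$5 - Z$5) = 0" "d * (r * E$6 + s * (J E)$6 - Z$6) = 0"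
    unfolding d_def by algebra+
  then have "Z$5 = r * E$5 + s * (J E)$5" "Z$6 = r * E$6 + s * (J E)$6"
    using \<open>d \<noteq> 0\<close> by simp_all
  then have "Z = r *\<^sub>R E + s *\<^sub>R J E"
    using EJE Z by (simp add: vec6_eq_iff centre61_def)
  then have "J Z = r *\<^sub>R J E + s *\<^sub>R (- E)"
    by (metis J_J matrix_vector_mult_scaleR matrix_vector_right_distrib)
  then show False
    using EJE \<open>J Z \<notin> centre61\<close> subspace_centre61
    by (metis subspace_add subspace_neg subspace_scale)
qed

section \<open>The action of J on the centre\<close>

abbreviation a :: real where "a \<equiv> A $ 5 $ 5"
abbreviation b :: real where "b \<equiv> A $ 5 $ 6"
abbreviation c :: real where "c \<equiv> A $ 6 $ 5"

lemma entries_centre [simp]: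
  "A$1$5 = 0" "A$2$5 = 0" "A$3$5 = 0" "A$4$5 = 0" "A$1$6 = 0" "A$2$6 = 0" "A$3$6 = 0" "A$4$6 = 0"
  using J_centre[OF centre61_axis(1)[of 1]] J_centre[OF centre61_axis(2)[of 1]]
  by (simp_all add: matrix_vector_mult_basis column_def centre61_def)

lemma square_entry: "(\<Sum>l\<in>UNIV. A$i$l * A$l$j) = (if i = j then -1 else 0)"
proof -
  have "(J (J (axis j 1))) $ i = (\<Sum>l\<in>UNIV. A$i$l * A$l$j)"
    by (simp only: matrix_vector_mult_basis) (simp add: matrix_vector_mult_def column_def)
  then show ?thesis by (simp only: J_J) (auto simp: axis_def)
qed

text \<open>Columns 5 and 6 vanish outside rows 5 and 6, so the lower right block squares to -1 by
  itself. If \<open>b\<close> were zero, the real number \<open>a\<close> would have square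
  -1.\<close>

lemma centre_block: "a * a + b * c = -1" "b \<noteq> 0" "A$6$6 = - a"
proof -
  have 1: "a * a + b * c = -1" using square_entry[of 5 5] by (simp add: sum_6)
  have 2: "a * b + b * A$6$6 = 0" using square_entry[of 5 6] by (simp add: sum_6)
  show "a * a + b * c = -1" by fact
  show b: "b \<noteq> 0"
  proof
    assume "b = 0"
    then have "a * a = -1" using 1 by simp
    then show False by (metis not_square_less_zero less_minus_one_simps(1))
  qed
  have "b * (a + A$6$6) = 0" using 2 by (simp add: algebra_simps)
  then show "A$6$6 = - a" using b by simp
qed

lemma c_eq: "c = - (1 + a\<^sup>2) / b"
  using centre_block by (simp add: field_simps power2_eq_square)

lemma J_on_centre:
  "Z \<in> centre61 \<Longrightarrow> J Z = (a * Z$5 + b * Z$6) *\<^sub>R axis 5 1 + (c * Z$5 - a * Z$6) *\<^sub>R axis 6 1"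
  using centre_block(3) by (simp add: vec6_eq_iff matrix_vector_mult_def sum_6 centre61_def axis_def)

end

subsection \<open>Equivalences from adapted bases\<close>

definition lin6 :: "(6 \<Rightarrow> real^6) \<Rightarrow> real^6 \<Rightarrow> real^6" where
  "lin6 y X = (\<Sum>i\<in>UNIV. X$i *\<^sub>R y i)"

lemma linear_lin6: "linear (lin6 y)"
  by (rule linearI) (simp_all add: lin6_def scaleR_add_left sum.distrib scaleR_sum_right)

text \<open>
  Injectivity is free away from the centre: the kernel of a Lie algebra morphism that is injective
  on the centre is an ideal meeting the centre trivially, so it commutes with everything.
\<close>

lemma equiv61I:
  fixes y :: "6 \<Rightarrow> real^6"
  assumes y5: "y 5 \<in> centre61" and y6: "y 6 \<in> centre61"
    and br: "br61 (y 1) (y 2) = y 5" "br61 (y 1) (y 4) = y 6" "br61 (y 2) (y 3) = y 6"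
      "br61 (y 1) (y 3) = 0" "br61 (y 2) (y 4) = 0" "br61 (y 3) (y 4) = 0"
    and ind: "y 5 $ 5 * y 6 $ 6 - y 5 $ 6 * y 6 $ 5 \<noteq> 0"
    and J: "\<And>j. A *v y j = (\<Sum>k\<in>UNIV. B $ k $ j *\<^sub>R y k)"
  shows "equiv61 A B"
proof -
  note br' = br61_skew[of "y 2" "y 1"] br61_skew[of "y 4" "y 1"] br61_skew[of "y 3" "y 2"]
    br61_skew[of "y 3" "y 1"] br61_skew[of "y 4" "y 2"] br61_skew[of "y 4" "y 3"]
  have hom: "lin6 y (br61 X Y) = br61 (lin6 y X) (lin6 y Y)" for X Y
  proof -
    have "br61 (lin6 y X) (lin6 y Y) =
        (X$1 * Y$2) *\<^sub>R y 5 - (X$2 * Y$1) *\<^sub>R y 5 + (X$1 * Y$4) *\<^sub>R y 6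
          - (X$4 * Y$1) *\<^sub>R y 6 + (X$2 * Y$3) *\<^sub>R y 6 - (X$3 * Y$2) *\<^sub>R y 6"
      unfolding lin6_def sum_6
      by (simp only: br61_add_left br61_add_right br61_scaleR_left br61_scaleR_right br br'
          br61_centre[OF y5] br61_centre[OF y6] br61_self scaleR_zero_right add_0_left add_0_right
          minus_zero scaleR_minus_right diff_conv_add_uminus scaleR_scaleR scaleR_add_right ac_simps)
    then show ?thesis
      unfolding lin6_def sum_6 by (simp add: scaleR_add_left scaleR_diff_left)
  qed
  have inj0: "Z = 0" if "Z \<in> centre61" "lin6 y Z = 0" for Z
  proof -
    have z: "Z$5 * y 5 $ 5 + Z$6 * y 6 $ 5 = 0" "Z$5 * y 5 $ 6 + Z$6 * y 6 $ 6 = 0"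
      using that by (simp_all add: lin6_def sum_6 centre61_def vec6_eq_iff)
    have "Z$5 * (y 5 $ 5 * y 6 $ 6 - y 5 $ 6 * y 6 $ 5) = 0"
      "Z$6 * (y 5 $ 5 * y 6 $ 6 - y 5 $ 6 * y 6 $ 5) = 0"
      using z by algebra+
    then show "Z = 0" using ind that by (simp add: vec6_eq_iff centre61_def)
  qed
  have "X = 0" if X: "lin6 y X = 0" for X
  proof -
    have "br61 X Y = 0" for Y
    proof (rule inj0)
      show "lin6 y (br61 X Y) = 0" by (simp only: hom X) (simp add: vec6_eq_iff)
    qed simp
    then show ?thesis using inj0 X in_centre61_if_commutes by blast
  qed
  then have "inj (lin6 y)"
    using linear_lin6 linear_injective_0 by blast
  then have bij: "bij (lin6 y)"
    using linear_lin6 linear_injective_imp_surjective by (auto simp: bij_def)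
  have eq: "A *v lin6 y X = lin6 y (B *v X)" for X
  proof -
    have "A *v lin6 y X = (\<Sum>j\<in>UNIV. X$j *\<^sub>R (A *v y j))"
      unfolding lin6_def
      by (simp add: linear_sum[OF matrix_vector_mul_linear] matrix_vector_mult_scaleR)
    also have "\<dots> = (\<Sum>j\<in>UNIV. \<Sum>k\<in>UNIV. (B $ k $ j * X $ j) *\<^sub>R y k)"
      by (simp add: J scaleR_sum_right mult.commute)
    also have "\<dots> = (\<Sum>k\<in>UNIV. \<Sum>j\<in>UNIV. (B $ k $ j * X $ j) *\<^sub>R y k)"
      by (rule sum.swap)
    also have "\<dots> = lin6 y (B *v X)"
      by (simp add: lin6_def matrix_vector_mult_def scaleR_sum_left)
    finally show ?thesis .
  qed
  have "(*v) B = inv (lin6 y) \<circ> (*v) A \<circ> lin6 y"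
    using bij by (auto simp: eq bij_def inv_f_f)
  then show ?thesis
    unfolding equiv61_def equivalent_structures_def lie_automorphism_def
    using linear_lin6 bij hom by blast
qed

section \<open>The slice charts\<close>

definition of_cols :: "(6 \<Rightarrow> real^6) \<Rightarrow> real^6^6" where
  "of_cols y = (\<chi> i j. y j $ i)"

lemma of_cols_mult: "of_cols y *v X = lin6 y X"
  by (simp add: vec_eq_iff of_cols_def matrix_vector_mult_def lin6_def mult.commute)

lemma mult_of_cols: "X ** of_cols y = of_cols (\<lambda>j. X *v y j)"
  by (simp add: vec_eq_iff of_cols_def matrix_matrix_mult_def matrix_vector_mult_def)

lemma of_cols_eq_iff: "of_cols y = of_cols y' \<longleftrightarrow> (\<forall>j. y j = y' j)"
  by (auto simp: vec_eq_iff of_cols_def)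

text \<open>
  Write \<open>u = x\<^sub>n\<close>, \<open>v = x\<^sub>1\<close> and let \<open>B\<close> be the restriction of \<open>J\<close> to the centre; \<open>B\<^sup>2 = -1\<close> makes
  it a function of its first row (\<open>central_part\<close>). Integrability at \<open>(u, v)\<close> reads
  \<open>K(Ju) = [u, v] + B [u, Jv]\<close> with \<open>K(Y) = [Y, Jv] - B [Y, v]\<close>, which is linear in \<open>Ju\<close> and determines the
  entries \<open>4\<close> and \<open>j\<close> of \<open>Ju\<close> from the others as soon as \<open>K x\<^sub>4\<close>, \<open>K x\<^sub>j\<close> are independent. Then \<open>J\<close> is known
  on the basis \<open>u, v, Ju, Jv, x\<^sub>5, x\<^sub>6\<close>.
\<close>

definition central_part :: "real^6^6 \<Rightarrow> real^6 \<Rightarrow> real^6" where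
  "central_part X Z = (X$5$5 * Z$5 + X$5$6 * Z$6) *\<^sub>R axis 5 1
     + (- (1 + (X$5$5)\<^sup>2) / X$5$6 * Z$5 - X$5$5 * Z$6) *\<^sub>R axis 6 1"

definition K61 :: "real^6^6 \<Rightarrow> real^6 \<Rightarrow> real^6" where
  "K61 X Y = br61 Y (X *v axis 1 1) - central_part X (br61 Y (axis 1 1))"

definition partial_col :: "6 \<Rightarrow> 6 \<Rightarrow> real^6^6 \<Rightarrow> real^6" where
  "partial_col n j X = (\<chi> k. if k = 4 \<or> k = j then 0 else X $ k $ n)"

definition col_rhs :: "6 \<Rightarrow> 6 \<Rightarrow> real^6^6 \<Rightarrow> real^6" where
  "col_rhs n j X = br61 (axis n 1) (axis 1 1) + central_part X (br61 (axis n 1) (X *v axis 1 1))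
     - K61 X (partial_col n j X)"

definition K61_det :: "6 \<Rightarrow> real^6^6 \<Rightarrow> real" where
  "K61_det j X = K61 X (axis 4 1) $ 5 * K61 X (axis j 1) $ 6
     - K61 X (axis 4 1) $ 6 * K61 X (axis j 1) $ 5"

text \<open>Cramer's rule for entries \<open>4\<close> and \<open>j\<close>: the value that column
  \<open>n\<close> must take for integrability at the pair \<open>(x\<^sub>n, x\<^sub>1)\<close>,
  given its other entries.\<close>

definition solved_col :: "6 \<Rightarrow> 6 \<Rightarrow> real^6^6 \<Rightarrow> real^6" where
  "solved_col n j X = partial_col n j X
     + ((col_rhs n j X $ 5 * K61 X (axis j 1) $ 6 - col_rhs n j X $ 6 * K61 X (axis j 1) $ 5) / K61_det j X)
         *\<^sub>R axis 4 1
     + ((K61 X (axis 4 1) $ 5 * col_rhs n j X $ 6 - K61 X (axis 4 1) $ 6 * col_rhs n j X $ 5) / K61_det j X)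
         *\<^sub>R axis j 1"

definition basis_cols :: "6 \<Rightarrow> 6 \<Rightarrow> real^6^6 \<Rightarrow> 6 \<Rightarrow> real^6" where
  "basis_cols n j X i =
     (vector [axis n 1, axis 1 1, solved_col n j X, X *v axis 1 1, axis 5 1, axis 6 1] :: real^6^6) $ i"

text \<open>What a complex structure must do to \<open>basis_cols\<close>: third and fourth images
  come from squaring to -1.\<close>

definition image_cols :: "6 \<Rightarrow> 6 \<Rightarrow> real^6^6 \<Rightarrow> 6 \<Rightarrow> real^6" where
  "image_cols n j X i =
     (vector [solved_col n j X, X *v axis 1 1, - axis n 1, - axis 1 1, central_part X (axis 5 1), central_part X (axis 6 1)]
        :: real^6^6) $ i"

text \<open>The candidate complex structure built from part of the entries of \<open>X\<close>. For
  \<open>j \<noteq> 4\<close> its fixed points in \<open>chart_dom\<close> are exactly the complex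
  structures there.\<close>

definition chart_map :: "6 \<Rightarrow> 6 \<Rightarrow> real^6^6 \<Rightarrow> real^6^6" where
  "chart_map n j X = of_cols (image_cols n j X) ** matrix_inv (of_cols (basis_cols n j X))"

definition chart_dom :: "6 \<Rightarrow> 6 \<Rightarrow> (real^6^6) set" where
  "chart_dom n j = {X. X$5$6 \<noteq> 0 \<and> K61_det j X \<noteq> 0 \<and> det (of_cols (basis_cols n j X)) \<noteq> 0}"

lemma basis_cols_simps [simp]:
  "basis_cols n j X 1 = axis n 1" "basis_cols n j X 2 = axis 1 1" "basis_cols n j X 3 = solved_col n j X"
  "basis_cols n j X 4 = X *v axis 1 1" "basis_cols n j X 5 = axis 5 1" "basis_cols n j X 6 = axis 6 1"
  by (simp_all add: basis_cols_def vector_6)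

lemma image_cols_simps [simp]:
  "image_cols n j X 1 = solved_col n j X" "image_cols n j X 2 = X *v axis 1 1" "image_cols n j X 3 = - axis n 1"
  "image_cols n j X 4 = - axis 1 1" "image_cols n j X 5 = central_part X (axis 5 1)" "image_cols n j X 6 = central_part X (axis 6 1)"
  by (simp_all add: image_cols_def vector_6)

lemma central_part_in_centre [simp]: "central_part X Z \<in> centre61"
  by (simp add: central_part_def centre61_def axis_def)

lemma central_part_add: "central_part X (Y + Z) = central_part X Y + central_part X Z"
  and central_part_scaleR: "central_part X (r *\<^sub>R Z) = r *\<^sub>R central_part X Z"
  by (simp_all add: central_part_def vec6_eq_iff axis_def algebra_simps add_divide_distrib diff_divide_distrib)

lemma central_part_central_part:
  assumes "X$5$6 \<noteq> 0" "Z \<in> centre61"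
  shows "central_part X (central_part X Z) = - Z"
  using assms by (simp add: central_part_def vec6_eq_iff axis_def centre61_def field_simps power2_eq_square)

lemma K61_add: "K61 X (Y + Z) = K61 X Y + K61 X Z"
  and K61_scaleR: "K61 X (r *\<^sub>R Y) = r *\<^sub>R K61 X Y"
  by (simp_all add: K61_def br61_add_left br61_scaleR_left central_part_add central_part_scaleR scaleR_diff_right)

lemma K61_in_centre: "K61 X Y \<in> centre61"
  unfolding K61_def by (intro subspace_diff subspace_centre61) simp_all

lemma col_rhs_in_centre: "col_rhs n j X \<in> centre61"
  unfolding col_rhs_def by (intro subspace_diff subspace_add subspace_centre61 K61_in_centre) simp_all

lemma K61_solved_col:
  assumes "K61_det j X \<noteq> 0"
  shows "K61 X (solved_col n j X) = br61 (axis n 1) (axis 1 1) + central_part X (br61 (axis n 1) (X *v axis 1 1))"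
proof -
  define s where "s = (col_rhs n j X $ 5 * K61 X (axis j 1) $ 6 - col_rhs n j X $ 6 * K61 X (axis j 1) $ 5) / K61_det j X"
  define t where "t = (K61 X (axis 4 1) $ 5 * col_rhs n j X $ 6 - K61 X (axis 4 1) $ 6 * col_rhs n j X $ 5) / K61_det j X"
  have "s * K61_det j X = col_rhs n j X $ 5 * K61 X (axis j 1) $ 6 - col_rhs n j X $ 6 * K61 X (axis j 1) $ 5"
    "t * K61_det j X = K61 X (axis 4 1) $ 5 * col_rhs n j X $ 6 - K61 X (axis 4 1) $ 6 * col_rhs n j X $ 5"
    using assms by (simp_all add: s_def t_def)
  then have "K61_det j X * (s * K61 X (axis 4 1) $ 5 + t * K61 X (axis j 1) $ 5 - col_rhs n j X $ 5) = 0"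
    "K61_det j X * (s * K61 X (axis 4 1) $ 6 + t * K61 X (axis j 1) $ 6 - col_rhs n j X $ 6) = 0"
    unfolding K61_det_def by algebra+
  then have "s *\<^sub>R K61 X (axis 4 1) + t *\<^sub>R K61 X (axis j 1) = col_rhs n j X"
    using assms K61_in_centre[of X "axis 4 1"] K61_in_centre[of X "axis j 1"] col_rhs_in_centre[of n j X]
    by (simp add: vec6_eq_iff centre61_def)
  moreover have "K61 X (solved_col n j X) =
      K61 X (partial_col n j X) + (s *\<^sub>R K61 X (axis 4 1) + t *\<^sub>R K61 X (axis j 1))"
    unfolding solved_col_def s_def[symmetric] t_def[symmetric]
    by (simp add: K61_add K61_scaleR)
  ultimately show ?thesis by (simp add: col_rhs_def)
qed

text \<open>The two unknown entries enter \<open>K61\<close> linearly, so Cramer's rule recovers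
  them; \<open>j \<noteq> 4\<close> keeps their positions distinct.\<close>

lemma solved_col_unique:
  assumes "K61_det j X \<noteq> 0" "j \<noteq> 4"
    and "K61 X (X *v axis n 1) = br61 (axis n 1) (axis 1 1) + central_part X (br61 (axis n 1) (X *v axis 1 1))"
  shows "solved_col n j X = X *v axis n 1"
proof -
  have e: "X *v axis n 1 = partial_col n j X + X$4$n *\<^sub>R axis 4 1 + X$j$n *\<^sub>R axis j 1"
    unfolding matrix_vector_mult_basis
    using assms(2) by (auto simp: vec_eq_iff partial_col_def axis_def column_def)
  have r: "col_rhs n j X = X$4$n *\<^sub>R K61 X (axis 4 1) + X$j$n *\<^sub>R K61 X (axis j 1)"
    using assms(3) unfolding e by (simp add: col_rhs_def K61_add K61_scaleR algebra_simps)
  have "col_rhs n j X $ 5 * K61 X (axis j 1) $ 6 - col_rhs n j X $ 6 * K61 X (axis j 1) $ 5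
      = X$4$n * K61_det j X"
    "K61 X (axis 4 1) $ 5 * col_rhs n j X $ 6 - K61 X (axis 4 1) $ 6 * col_rhs n j X $ 5
      = X$j$n * K61_det j X"
    unfolding r K61_det_def by (simp_all add: algebra_simps)
  then show ?thesis using assms(1) by (simp add: solved_col_def e)
qed

lemma chart_map_iff:
  assumes "X \<in> chart_dom n j"
  shows "Y = chart_map n j X \<longleftrightarrow> (\<forall>i. Y *v basis_cols n j X i = image_cols n j X i)"
proof -
  let ?P = "of_cols (basis_cols n j X)"
  have inv: "invertible ?P" using assms by (simp add: chart_dom_def invertible_det_nz)
  have "Y = chart_map n j X \<longleftrightarrow> Y ** ?P = of_cols (image_cols n j X)"
  proof
    assume "Y = chart_map n j X"
    then show "Y ** ?P = of_cols (image_cols n j X)"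
      by (simp add: chart_map_def matrix_inv_inverse[OF inv] flip: matrix_mul_assoc)
  next
    assume "Y ** ?P = of_cols (image_cols n j X)"
    then have "chart_map n j X = Y ** (?P ** matrix_inv ?P)"
      by (simp add: chart_map_def matrix_mul_assoc)
    then show "Y = chart_map n j X" by (simp add: matrix_inv_inverse[OF inv])
  qed
  then show ?thesis by (simp add: mult_of_cols of_cols_eq_iff)
qed

section \<open>Every complex structure is a fixed point in some chart domain\<close>

context cs61
begin

lemma J_eq_central_part: "Z \<in> centre61 \<Longrightarrow> J Z = central_part A Z"
  using J_on_centre[of Z] c_eq by (simp add: central_part_def)

lemma K61_eq: "K61 A Y = br61 Y (J (axis 1 1)) - J (br61 Y (axis 1 1))"
  by (simp add: K61_def J_eq_central_part)

text \<open>Integrability at \<open>(Y, x\<^sub>1)\<close> says that \<open>K61 A\<close> is complex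
  linear. Its image is therefore J-invariant, so it is the whole centre once it is nonzero.\<close>

lemma K61_J: "K61 A (J Y) = J (K61 A Y)"
  using integrable[of Y "axis 1 1"]
  by (simp add: K61_eq matrix_vector_mult_diff_distrib algebra_simps)

lemma solved_col_eq:
  assumes "K61_det j A \<noteq> 0" "j \<noteq> 4"
  shows "solved_col n j A = J (axis n 1)"
proof (rule solved_col_unique[OF assms])
  show "K61 A (J (axis n 1)) = br61 (axis n 1) (axis 1 1) + central_part A (br61 (axis n 1) (J (axis 1 1)))"
    using integrable[of "axis n 1" "axis 1 1"] by (simp add: K61_eq J_eq_central_part algebra_simps)
qed

lemma fixed_point_chart_map:
  assumes "A \<in> chart_dom n j" "j \<noteq> 4"
  shows "A = chart_map n j A"
proof -
  have "solved_col n j A = J (axis n 1)" using assms by (intro solved_col_eq) (simp_all add: chart_dom_def)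
  then show ?thesis
    unfolding chart_map_iff[OF assms(1)] forall_6 by (simp add: J_eq_central_part)
qed

text \<open>\<open>K x\<^sub>4\<close> is nonzero, with fifth entry \<open>b\<close>. If all three
  determinants vanished, the image of K would be the real line through \<open>K x\<^sub>4\<close>,
  yet J-invariant.\<close>

lemma exists_K61_det: "\<exists>j\<in>{1,2,3}. K61_det j A \<noteq> 0"
proof (rule ccontr)
  assume "\<not> ?thesis"
  then have 0: "K61_det 1 A = 0" "K61_det 2 A = 0" "K61_det 3 A = 0" by auto
  define k where "k = K61 A (axis 4 1)"
  have k5: "k $ 5 = b"
    unfolding k_def K61_def central_part_def by (simp add: axis_def)
  have Kd: "k$5 * K61 A Y $ 6 - k$6 * K61 A Y $ 5 = 0" for Y
  proof -
    have K5: "K61 A Y $ 5 = Y$1 * K61 A (axis 1 1) $ 5 + Y$2 * K61 A (axis 2 1) $ 5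
        + Y$3 * K61 A (axis 3 1) $ 5 + Y$4 * k $ 5"
      and K6: "K61 A Y $ 6 = Y$1 * K61 A (axis 1 1) $ 6 + Y$2 * K61 A (axis 2 1) $ 6
        + Y$3 * K61 A (axis 3 1) $ 6 + Y$4 * k $ 6"
      by (simp_all add: K61_def central_part_def k_def axis_6 algebra_simps)
    show ?thesis
      using 0 unfolding K5 K6 K61_det_def k_def[symmetric] by algebra
  qed
  have Jk: "J k = (a * k$5 + b * k$6) *\<^sub>R axis 5 1 + (c * k$5 - a * k$6) *\<^sub>R axis 6 1"
    unfolding k_def by (rule J_on_centre[OF K61_in_centre])
  have "k$5 * (c * k$5 - a * k$6) - k$6 * (a * k$5 + b * k$6) = 0"
    using Kd[of "J (axis 4 1)"] unfolding K61_J k_def[symmetric] Jk by (simp add: axis_def)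
  \<comment> \<open>Multiplying by \<open>b\<close> and substituting
    \<open>b * c = -1 - a * a\<close> turns the quadratic form into minus a sum of two
    squares.\<close>
  then have "k$5 * k$5 + (a * k$5 + b * k$6) * (a * k$5 + b * k$6) = 0"
    using centre_block(1) by algebra
  then have "k$5 = 0" by (simp add: sum_squares_eq_zero_iff)
  then show False using k5 centre_block(2) by simp
qed

text \<open>Modulo the centre \<open>J x\<^sub>1\<close> is no multiple of \<open>x\<^sub>1\<close>,
  so it has a nonzero entry \<open>m\<close> in {2,3,4}. Any other \<open>n\<close> in that set puts
  \<open>x\<^sub>n\<close> outside the complex line of \<open>x\<^sub>1\<close>, and the two complex
  lines together give a basis.\<close>

lemma exists_chart_dom: "\<exists>n\<in>{2,3,4}. \<exists>j\<in>{1,2,3}. A \<in> chart_dom n j"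
proof -
  obtain j where j: "j \<in> {1,2,3}" "K61_det j A \<noteq> 0" using exists_K61_det by blast
  then have j4: "j \<noteq> 4" by auto
  define x :: "real^6" where "x = axis 1 1"
  define h where "h = J x"
  have "h$2 \<noteq> 0 \<or> h$3 \<noteq> 0 \<or> h$4 \<noteq> 0"
  proof (rule ccontr)
    assume "\<not> ?thesis"
    then have "A$2$1 = 0" "A$3$1 = 0" "A$4$1 = 0"
      by (auto simp: h_def x_def matrix_vector_mult_basis column_def)
    then have "A$1$1 * A$1$1 = -1" using square_entry[of 1 1] by (simp add: sum_6)
    then show False by (metis not_square_less_zero less_minus_one_simps(1))
  qed
  then obtain m n :: 6 where mn: "n \<in> {2,3,4}" "m \<in> {2,3,4}" "m \<noteq> n" "h$m \<noteq> 0"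
  proof (cases "h$2 = 0")
    case True
    then show ?thesis
      using \<open>h$2 \<noteq> 0 \<or> h$3 \<noteq> 0 \<or> h$4 \<noteq> 0\<close> that[of 2 3] that[of 2 4] by auto
  next
    case False
    then show ?thesis using that[of 3 2] by auto
  qed
  define u :: "real^6" where "u = axis n 1"
  have Ju: "solved_col n j A = J u" unfolding u_def using solved_col_eq[OF j(2) j4] .
  have "q = 0" if q: "of_cols (basis_cols n j A) *v q = 0" for q
  proof -
    have q0: "q$1 *\<^sub>R u + q$2 *\<^sub>R x + q$3 *\<^sub>R J u + q$4 *\<^sub>R h + q$5 *\<^sub>R axis 5 1 + q$6 *\<^sub>R axis 6 1 = 0"
      using q unfolding of_cols_mult lin6_def sum_6 by (simp add: Ju u_def x_def h_def)
    define V where "V = q$1 *\<^sub>R u + q$2 *\<^sub>R x + q$3 *\<^sub>R J u + q$4 *\<^sub>R h"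
    have "V = - (q$5 *\<^sub>R axis 5 1 + q$6 *\<^sub>R axis 6 1)"
      using q0 unfolding V_def by (simp only: eq_neg_iff_add_eq_0 add.assoc)
    then have V: "V \<in> centre61"
      by (simp add: centre61_def axis_def)
    \<comment> \<open>Multiplication by the complex conjugate of the coefficient of \<open>u\<close>
      removes \<open>J u\<close>; rows \<open>m\<close> and \<open>n\<close> then finish.\<close>
    have "q$1 *\<^sub>R V - q$3 *\<^sub>R J V \<in> centre61"
      using V J_centre[OF V] by (intro subspace_diff subspace_scale subspace_centre61)
    moreover have "q$1 *\<^sub>R V - q$3 *\<^sub>R J V =
      (q$1 * q$1 + q$3 * q$3) *\<^sub>R u + (q$1 * q$2 + q$3 * q$4) *\<^sub>R x
        + (q$1 * q$4 - q$3 * q$2) *\<^sub>R h"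
      unfolding V_def
      by (simp add: matrix_vector_right_distrib matrix_vector_mult_scaleR h_def algebra_simps)
    ultimately have C: "((q$1 * q$1 + q$3 * q$3) *\<^sub>R u + (q$1 * q$2 + q$3 * q$4) *\<^sub>R x
        + (q$1 * q$4 - q$3 * q$2) *\<^sub>R h) $ i = 0" if "i \<in> {1,2,3,4}" for i
      using that by (auto simp: centre61_def)
    have um: "u$m = 0" "u$n = 1" "x$m = 0" "x$n = 0" "x$1 = 1"
      using mn by (auto simp: u_def x_def axis_def)
    have "(q$1 * q$4 - q$3 * q$2) * h$m = 0"
      using C[of m] mn um by auto
    then have 14: "q$1 * q$4 - q$3 * q$2 = 0" using mn by simp
    have "q$1 * q$1 + q$3 * q$3 = 0"
      using C[of n] mn um 14 by auto
    then have 13: "q$1 = 0" "q$3 = 0" by (simp_all add: sum_squares_eq_zero_iff)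
    have "V$m = 0" "V$1 = 0" using V mn by (auto simp: centre61_def)
    then have 24: "q$4 = 0" "q$2 = 0" using mn um by (simp_all add: V_def 13)
    show "q = 0"
      using q0 13 24 by (simp add: vec6_eq_iff axis_def)
  qed
  then have "det (of_cols (basis_cols n j A)) \<noteq> 0"
    using matrix_left_invertible_ker invertible_left_inverse invertible_det_nz by blast
  then show ?thesis
    using j mn centre_block(2) by (auto simp: chart_dom_def)
qed

end

text \<open>
  The Nijenhuis tensor \<open>N\<close> satisfies \<open>N(JX, Y) = - J N(X, Y)\<close>, so it is enough to know that it vanishes
  on the pair \<open>(x\<^sub>n, x\<^sub>1)\<close>.
\<close>

lemma fixed_point_in_X61:
  assumes U: "X \<in> chart_dom n j" and fp: "X = chart_map n j X"
  shows "X \<in> X61"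
proof -
  define u :: "real^6" where "u = axis n 1"
  define v :: "real^6" where "v = axis 1 1"
  define w where "w = solved_col n j X"
  have "\<forall>i. X *v basis_cols n j X i = image_cols n j X i"
    using chart_map_iff[OF U] fp by blast
  then have Xu: "X *v u = w" and Xw: "X *v w = - u" and Xv: "X *v (X *v v) = - v"
    and X56: "X *v axis 5 1 = central_part X (axis 5 1)" "X *v axis 6 1 = central_part X (axis 6 1)"
    unfolding forall_6 by (simp_all add: u_def v_def w_def)
  have nz: "X$5$6 \<noteq> 0" "K61_det j X \<noteq> 0" using U by (simp_all add: chart_dom_def)
  have XZ: "X *v Z = central_part X Z" if "Z \<in> centre61" for Z
  proof -
    have "X *v (Z$5 *\<^sub>R axis 5 1 + Z$6 *\<^sub>R axis 6 1) = central_part X (Z$5 *\<^sub>R axis 5 1 + Z$6 *\<^sub>R axis 6 1)"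
      by (simp add: matrix_vector_right_distrib matrix_vector_mult_scaleR X56 central_part_add central_part_scaleR)
    then show ?thesis using centre61_decomp[OF that] by simp
  qed
  have XZ': "X *v Z \<in> centre61" if "Z \<in> centre61" for Z
    using XZ[OF that] by simp
  have XXZ: "X *v (X *v Z) = - Z" if "Z \<in> centre61" for Z
    using XZ XZ'[OF that] that nz by (simp add: central_part_central_part)
  have span: "\<exists>c1 c2 c3 c4 Z. Y = c1 *\<^sub>R u + c2 *\<^sub>R v + c3 *\<^sub>R (X *v u) + c4 *\<^sub>R (X *v v) + Z \<and> Z \<in> centre61"
    for Y
  proof -
    have "invertible (of_cols (basis_cols n j X))"
      using U by (simp add: chart_dom_def invertible_det_nz)
    then have "of_cols (basis_cols n j X) *v (matrix_inv (of_cols (basis_cols n j X)) *v Y) = Y"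
      by (simp add: matrix_vector_mul_assoc matrix_inv_inverse)
    then obtain q where "lin6 (basis_cols n j X) q = Y" unfolding of_cols_mult by blast
    then have "Y = q$1 *\<^sub>R u + q$2 *\<^sub>R v + q$3 *\<^sub>R (X *v u) + q$4 *\<^sub>R (X *v v)
        + (q$5 *\<^sub>R axis 5 1 + q$6 *\<^sub>R axis 6 1)"
      unfolding lin6_def sum_6 by (simp add: u_def v_def Xu[unfolded u_def] w_def add.assoc)
    moreover have "q$5 *\<^sub>R axis 5 1 + q$6 *\<^sub>R axis 6 1 \<in> centre61"
      by (simp add: centre61_def axis_def)
    ultimately show ?thesis by blast
  qed
  have XX: "X *v (X *v Y) = - Y" for Y
  proof -
    obtain c1 c2 c3 c4 Z
      where Y: "Y = c1 *\<^sub>R u + c2 *\<^sub>R v + c3 *\<^sub>R (X *v u) + c4 *\<^sub>R (X *v v) + Z" and Z: "Z \<in> centre61"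
      using span by blast
    have Xu2: "X *v (X *v u) = - u" using Xu Xw by simp
    have m: "X *v (- T) = - (X *v T)" for T
      using matrix_vector_mult_scaleR[of X "-1" T] by simp
    show ?thesis
      unfolding Y
      by (simp add: matrix_vector_right_distrib matrix_vector_mult_scaleR Xu2 Xv XXZ[OF Z] m algebra_simps)
  qed
  define N where "N Y Y' = br61 (X *v Y) (X *v Y') - br61 Y Y' - X *v (br61 (X *v Y) Y')
    - X *v (br61 Y (X *v Y'))" for Y Y'
  have m: "X *v (- T) = - (X *v T)" for T
    using matrix_vector_mult_scaleR[of X "-1" T] by simp
  have N_left: "N (c *\<^sub>R Y) T = c *\<^sub>R N Y T" "N (Y + Y') T = N Y T + N Y' T" for c Y Y' T
    by (simp_all add: N_def matrix_vector_right_distrib matrix_vector_mult_scaleR br61_add_left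
        br61_scaleR_left algebra_simps)
  have N_skew: "N Y T = - N T Y" for Y T
    unfolding N_def br61_skew[of T] br61_skew[of "X *v T"]
    by (simp add: m algebra_simps)
  have N_X: "N (X *v Y) T = - (X *v N Y T)" for Y T
    by (simp add: N_def XX m matrix_vector_mult_diff_distrib br61_minus_left algebra_simps)
  have N_Z: "N Z T = 0" if "Z \<in> centre61" for Z T
    using that XZ'[OF that] by (simp add: N_def)
  \<comment> \<open>The equation solved by \<open>solved_col\<close> is exactly the vanishing of
    \<open>N\<close> at this pair.\<close>
  have uv: "N u v = 0"
    using K61_solved_col[OF nz(2), of n]
    unfolding N_def K61_def XZ[OF br61_in_centre] Xu
    by (simp add: u_def v_def w_def algebra_simps)
  have N_self: "N T T = 0" for T
    by (simp add: N_def br61_skew[of T "X *v T"] m)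
  \<comment> \<open>Spanning reduces the first argument to \<open>u\<close>, \<open>v\<close> and
    the centre; skew symmetry then handles the second.\<close>
  have N_v: "N Y v = 0" and N_u: "N Y u = 0" for Y
  proof -
    obtain c1 c2 c3 c4 Z
      where Y: "Y = c1 *\<^sub>R u + c2 *\<^sub>R v + c3 *\<^sub>R (X *v u) + c4 *\<^sub>R (X *v v) + Z" and Z: "Z \<in> centre61"
      using span by blast
    show "N Y v = 0" "N Y u = 0"
      unfolding Y using uv N_skew[of v u] N_self N_Z[OF Z] by (simp_all add: N_left N_X)
  qed
  have "N Y T = 0" for Y T
  proof -
    obtain c1 c2 c3 c4 Z
      where T: "T = c1 *\<^sub>R u + c2 *\<^sub>R v + c3 *\<^sub>R (X *v u) + c4 *\<^sub>R (X *v v) + Z" and Z: "Z \<in> centre61"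
      using span by blast
    have "N u Y = 0" "N v Y = 0" using N_skew[of u Y] N_skew[of v Y] N_u[of Y] N_v[of Y] by simp_all
    then have "N T Y = 0" unfolding T by (simp add: N_left N_X N_Z[OF Z])
    then show ?thesis using N_skew[of Y T] by simp
  qed
  then show ?thesis
    unfolding X61_def complex_structure_def N_def using XX by simp
qed

lemma X61_iff_fixed_point:
  assumes "X \<in> chart_dom n j" "j \<noteq> 4"
  shows "X \<in> X61 \<longleftrightarrow> X = chart_map n j X"
  using fixed_point_in_X61[OF assms(1)] cs61.fixed_point_chart_map[OF cs61.intro assms] by blast

subsection \<open>Smoothness\<close>

lemma smooth_map_on_scaleR_const:
  "open S \<Longrightarrow> smooth_map_on S r \<Longrightarrow> smooth_map_on S (\<lambda>x. r x *\<^sub>R e)"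
  using smooth_map_on_compose_linear[OF _ bounded_linear_scaleR_left] .

lemma smooth_map_on_entry: "open S \<Longrightarrow> smooth_map_on S (\<lambda>X :: real^'n^'m. X $ k $ l)"
  by (intro smooth_map_on_nth smooth_map_on_linear bounded_linear_ident)

lemma smooth_map_on_matrix_vector_mult:
  "open S \<Longrightarrow> smooth_map_on S (\<lambda>X :: real^'n^'m. X *v e)"
  by (rule smooth_map_on_vecI)
    (auto simp: matrix_vector_mult_def
      intro!: smooth_map_on_sum smooth_map_on_mult smooth_map_on_const smooth_map_on_entry)

lemma smooth_map_on_br61:
  assumes "open S" "smooth_map_on S f" "smooth_map_on S g"
  shows "smooth_map_on S (\<lambda>X. br61 (f X) (g X))"
  unfolding br61_def
  by (intro smooth_map_on_add smooth_map_on_diff smooth_map_on_mult smooth_map_on_scaleR_const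
      smooth_map_on_nth assms)

lemma smooth_map_on_of_cols:
  assumes "open S" "\<And>i. smooth_map_on S (\<lambda>X. y X i)"
  shows "smooth_map_on S (\<lambda>X. of_cols (y X))"
  using smooth_map_on_nth[OF assms]
  by (auto simp: of_cols_def intro!: smooth_map_on_vecI[OF assms(1)])

lemma open_smooth_nonzero:
  assumes "open S" "smooth_map_on S (f :: _ \<Rightarrow> real)"
  shows "open {x \<in> S. f x \<noteq> 0}"
proof -
  have "open (f -` (- {0}) \<inter> S)"
    using assms smooth_map_on_imp_continuous_on
    by (intro continuous_on_open_vimage[THEN iffD1, rule_format]) auto
  moreover have "f -` (- {0}) \<inter> S = {x \<in> S. f x \<noteq> 0}" by auto
  ultimately show ?thesis by simp
qed

context
  fixes S :: "(real^6^6) set"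
  assumes S: "open S" and S56: "\<And>X. X \<in> S \<Longrightarrow> X$5$6 \<noteq> 0"
begin

lemma smooth_map_on_central_part:
  assumes "smooth_map_on S f"
  shows "smooth_map_on S (\<lambda>X. central_part X (f X))"
  unfolding central_part_def power2_eq_square
  by (intro smooth_map_on_add smooth_map_on_diff smooth_map_on_minus smooth_map_on_mult
      smooth_map_on_divide smooth_map_on_scaleR_const smooth_map_on_entry smooth_map_on_const
      smooth_map_on_nth assms S S56)

lemma smooth_map_on_K61:
  assumes "smooth_map_on S f"
  shows "smooth_map_on S (\<lambda>X. K61 X (f X))"
  unfolding K61_def
  by (intro smooth_map_on_diff smooth_map_on_br61 smooth_map_on_central_part
      smooth_map_on_matrix_vector_mult smooth_map_on_const assms S)

lemma smooth_map_on_K61_det: "smooth_map_on S (K61_det j)"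
  unfolding K61_det_def[abs_def]
  by (intro smooth_map_on_diff smooth_map_on_mult smooth_map_on_nth smooth_map_on_K61
      smooth_map_on_const S)

lemma smooth_map_on_partial_col: "smooth_map_on S (partial_col n j)"
proof (rule smooth_map_on_vecI[OF S])
  show "smooth_map_on S (\<lambda>X. partial_col n j X $ i)" for i
    by (cases "i = 4 \<or> i = j")
      (auto simp: partial_col_def intro!: smooth_map_on_const smooth_map_on_entry S)
qed

lemma smooth_map_on_col_rhs: "smooth_map_on S (col_rhs n j)"
  unfolding col_rhs_def[abs_def]
  by (intro smooth_map_on_diff smooth_map_on_add smooth_map_on_br61 smooth_map_on_central_part
      smooth_map_on_K61 smooth_map_on_matrix_vector_mult smooth_map_on_const smooth_map_on_partial_col S)

lemma smooth_map_on_solved_col: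
  assumes "\<And>X. X \<in> S \<Longrightarrow> K61_det j X \<noteq> 0"
  shows "smooth_map_on S (solved_col n j)"
  unfolding solved_col_def[abs_def]
  by (intro smooth_map_on_add smooth_map_on_scaleR_const smooth_map_on_divide smooth_map_on_diff
      smooth_map_on_mult smooth_map_on_nth smooth_map_on_K61 smooth_map_on_K61_det
      smooth_map_on_col_rhs smooth_map_on_partial_col smooth_map_on_const S assms)

lemma smooth_map_on_basis_cols:
  assumes "\<And>X. X \<in> S \<Longrightarrow> K61_det j X \<noteq> 0"
  shows "smooth_map_on S (\<lambda>X. of_cols (basis_cols n j X))"
proof -
  have "\<forall>i. smooth_map_on S (\<lambda>X. basis_cols n j X i)"
    unfolding forall_6 basis_cols_simps
    by (intro conjI smooth_map_on_solved_col smooth_map_on_matrix_vector_mult smooth_map_on_const S assms)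
  then show ?thesis by (intro smooth_map_on_of_cols S) blast
qed

lemma smooth_map_on_image_cols:
  assumes "\<And>X. X \<in> S \<Longrightarrow> K61_det j X \<noteq> 0"
  shows "smooth_map_on S (\<lambda>X. of_cols (image_cols n j X))"
proof -
  have "\<forall>i. smooth_map_on S (\<lambda>X. image_cols n j X i)"
    unfolding forall_6 image_cols_simps
    by (intro conjI smooth_map_on_solved_col smooth_map_on_central_part smooth_map_on_matrix_vector_mult
        smooth_map_on_const S assms)
  then show ?thesis by (intro smooth_map_on_of_cols S) blast
qed

end

text \<open>Each defining function is smooth only where the denominators before it are nonzero, so
  openness is obtained in nested stages.\<close>

lemma open_chart_dom: "open (chart_dom n j)"
proof -
  define S0 where "S0 = {X \<in> UNIV. (X :: real^6^6)$5$6 \<noteq> 0}"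
  have S0: "open S0"
    unfolding S0_def by (intro open_smooth_nonzero open_UNIV smooth_map_on_entry)
  have S056: "X$5$6 \<noteq> 0" if "X \<in> S0" for X using that by (simp add: S0_def)
  define S1 where "S1 = {X \<in> S0. K61_det j X \<noteq> 0}"
  have S1: "open S1"
    unfolding S1_def using S0 smooth_map_on_K61_det[OF S0 S056] by (rule open_smooth_nonzero)
  have "smooth_map_on S1 (\<lambda>X. of_cols (basis_cols n j X))"
    using S1 S056 by (rule smooth_map_on_basis_cols) (auto simp: S1_def)
  then have "open {X \<in> S1. det (of_cols (basis_cols n j X)) \<noteq> 0}"
    by (intro open_smooth_nonzero smooth_map_on_det S1)
  moreover have "{X \<in> S1. det (of_cols (basis_cols n j X)) \<noteq> 0} = chart_dom n j"
    by (auto simp: chart_dom_def S1_def S0_def)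
  ultimately show ?thesis by simp
qed

lemma smooth_map_on_chart_map: "smooth_map_on (chart_dom n j) (chart_map n j)"
  unfolding chart_map_def[abs_def]
  by (intro smooth_map_on_matrix_mult smooth_map_on_matrix_inv smooth_map_on_image_cols
      smooth_map_on_basis_cols open_chart_dom) (simp_all add: chart_dom_def)

subsection \<open>The free coordinates\<close>

text \<open>The entries that \<open>chart_map\<close> reads; for the indices used, 6 + 4 + 2 = 12 of
  them give the dimension.\<close>

definition free_coords :: "6 \<Rightarrow> 6 \<Rightarrow> (6 \<times> 6) set" where
  "free_coords n j = (\<lambda>k. (k, 1)) ` UNIV \<union> (\<lambda>k. (k, n)) ` (UNIV - {4, j}) \<union> {(5, 5), (5, 6)}"

definition proj :: "6 \<Rightarrow> 6 \<Rightarrow> real^6^6 \<Rightarrow> real^6^6" where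
  "proj n j X = (\<chi> k l. if (k, l) \<in> free_coords n j then X $ k $ l else 0)"

lemma linear_proj: "linear (proj n j)"
  by (rule linearI) (auto simp: proj_def vec_eq_iff)

lemma proj_proj: "proj n j (proj n j X) = proj n j X"
  by (auto simp: proj_def vec_eq_iff)

lemma card_free_coords:
  assumes "n \<in> {2,3,4}" "j \<in> {1,2,3}"
  shows "card (free_coords n j) = 12"
proof -
  let ?A = "(\<lambda>k::6. (k, 1::6)) ` UNIV" and ?B = "(\<lambda>k::6. (k, n)) ` (UNIV - {4, j})"
    and ?C = "{(5::6, 5::6), (5, 6)}"
  have "card (UNIV :: 6 set) = 6" by simp
  have "card ?A = 6" by (simp add: card_image inj_on_def)
  moreover have "card ?B = 4"
    using assms by (auto simp: card_image inj_on_def card_Diff_subset)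
  moreover have "card ?C = 2" by simp
  moreover have "?A \<inter> ?B = {}" "(?A \<union> ?B) \<inter> ?C = {}" using assms by auto
  ultimately show ?thesis
    unfolding free_coords_def by (subst card_Un_disjoint; simp add: card_Un_disjoint)
qed

lemma dim_range_proj:
  assumes "n \<in> {2,3,4}" "j \<in> {1,2,3}"
  shows "dim (range (proj n j)) = 12"
proof -
  define e :: "6 \<times> 6 \<Rightarrow> real^6^6" where "e = (\<lambda>(k, l). axis k (axis l 1))"
  have inner_e: "X \<bullet> e (k, l) = X $ k $ l" for X k l
    by (simp add: e_def inner_axis)
  have e_Basis: "Basis = range e"
    by (auto simp: e_def Basis_vec_def image_iff)
  have inj: "inj e"
  proof (rule injI, clarify)
    fix k l k' l' assume "e (k, l) = e (k', l')"
    then have "e (k, l) $ k $ l = e (k', l') $ k $ l" by simp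
    then show "k = k' \<and> l = l'" by (auto simp: e_def axis_def split: if_splits)
  qed
  have "range (proj n j) = {X. \<forall>i\<in>Basis. i \<notin> e ` free_coords n j \<longrightarrow> X \<bullet> i = 0}"
  proof (intro equalityI subsetI)
    fix X assume "X \<in> range (proj n j)"
    then show "X \<in> {X. \<forall>i\<in>Basis. i \<notin> e ` free_coords n j \<longrightarrow> X \<bullet> i = 0}"
      using inj by (auto simp: e_Basis inner_e proj_def inj_image_mem_iff)
  next
    fix X assume "X \<in> {X. \<forall>i\<in>Basis. i \<notin> e ` free_coords n j \<longrightarrow> X \<bullet> i = 0}"
    then have "proj n j X = X"
      using inj by (auto simp: e_Basis inner_e proj_def inj_image_mem_iff vec_eq_iff)
    then show "X \<in> range (proj n j)" by (metis rangeI)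
  qed
  moreover have "e ` free_coords n j \<subseteq> Basis" unfolding e_Basis by blast
  ultimately have "dim (range (proj n j)) = card (e ` free_coords n j)"
    by (simp only: dim_substandard)
  then show ?thesis
    using card_free_coords[OF assms] inj by (simp add: card_image inj_on_subset[OF inj])
qed

lemma proj_simps:
  "proj n j X *v axis 1 1 = X *v axis 1 1" "partial_col n j (proj n j X) = partial_col n j X"
  "proj n j X $ 5 $ 5 = X $ 5 $ 5" "proj n j X $ 5 $ 6 = X $ 5 $ 6"
  unfolding matrix_vector_mult_basis
  by (auto simp: vec_eq_iff column_def partial_col_def proj_def free_coords_def)

lemma central_part_proj: "central_part (proj n j X) = central_part X"
  by (rule ext) (simp add: central_part_def proj_simps)

lemma K61_proj: "K61 (proj n j X) = K61 X"
  by (rule ext) (simp add: K61_def proj_simps central_part_proj)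

lemma K61_det_proj: "K61_det i (proj n j X) = K61_det i X"
  by (simp add: K61_det_def K61_proj)

lemma solved_col_proj: "solved_col n j (proj n j X) = solved_col n j X"
  by (simp add: solved_col_def col_rhs_def K61_proj K61_det_proj central_part_proj proj_simps)

lemma basis_cols_proj: "basis_cols n j (proj n j X) = basis_cols n j X"
  by (rule ext) (simp add: basis_cols_def solved_col_proj proj_simps)

lemma image_cols_proj: "image_cols n j (proj n j X) = image_cols n j X"
  by (rule ext) (simp add: image_cols_def solved_col_proj central_part_proj proj_simps)

lemma chart_map_proj: "chart_map n j (proj n j X) = chart_map n j X"
  by (simp add: chart_map_def basis_cols_proj image_cols_proj)

lemma chart_dom_proj: "proj n j X \<in> chart_dom n j \<longleftrightarrow> X \<in> chart_dom n j"
  by (simp add: chart_dom_def basis_cols_proj K61_det_proj proj_simps)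

text \<open>\<open>basis_cols\<close> contains \<open>x\<^sub>1\<close>, \<open>x\<^sub>n\<close>,
  \<open>x\<^sub>5\<close>, \<open>x\<^sub>6\<close>, so these columns of the result are prescribed,
  and the prescription copies the free entries of \<open>X\<close>.\<close>

lemma proj_chart_map:
  assumes X: "X \<in> chart_dom n j"
  shows "proj n j (chart_map n j X) = proj n j X"
proof -
  let ?Y = "chart_map n j X"
  have "\<forall>i. ?Y *v basis_cols n j X i = image_cols n j X i"
    using chart_map_iff[OF X] by blast
  then have c: "column 1 ?Y = column 1 X" "column n ?Y = solved_col n j X"
    "column 5 ?Y = central_part X (axis 5 1)" "column 6 ?Y = central_part X (axis 6 1)"
    unfolding forall_6 by (simp_all add: matrix_vector_mult_basis)
  have "?Y $ k $ 1 = X $ k $ 1" for k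
    using arg_cong[OF c(1), of "\<lambda>v. v $ k"] by (simp add: column_def)
  moreover have "?Y $ k $ n = X $ k $ n" if "k \<noteq> 4" "k \<noteq> j" for k
    using arg_cong[OF c(2), of "\<lambda>v. v $ k"] that by (simp add: column_def solved_col_def partial_col_def axis_def)
  moreover have "?Y $ 5 $ 5 = X $ 5 $ 5" "?Y $ 5 $ 6 = X $ 5 $ 6"
    using arg_cong[OF c(3), of "\<lambda>v. v $ 5"] arg_cong[OF c(4), of "\<lambda>v. v $ 5"]
    by (simp_all add: column_def central_part_def axis_def)
  ultimately show ?thesis
    by (auto simp: proj_def vec_eq_iff free_coords_def)
qed

theorem smooth_submanifold_X61: "smooth_submanifold 12 X61"
  unfolding smooth_submanifold_def
proof
  fix A assume "A \<in> X61"
  then interpret cs61 A by unfold_locales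
  obtain n j where nj: "n \<in> {2,3,4}" "j \<in> {1,2,3}" and A: "A \<in> chart_dom n j"
    using exists_chart_dom by blast
  have j4: "j \<noteq> 4" using nj by auto
  show "\<exists>U V (\<phi> :: real^6^6 \<Rightarrow> real^6^6) \<psi> L. open U \<and> open V \<and> A \<in> U \<and> diffeomorphism U V \<phi> \<psi> \<and>
      subspace L \<and> dim L = 12 \<and> \<phi> ` (X61 \<inter> U) = L \<inter> V"
    unfolding dim_range_proj[OF nj, symmetric]
    by (rule graph_slice_chart[where \<pi> = "proj n j" and G = "chart_map n j"])
      (use A in \<open>simp_all only: linear_proj proj_proj open_chart_dom chart_dom_proj smooth_map_on_chart_map
        chart_map_proj proj_chart_map X61_iff_fixed_point[OF _ j4]\<close>)
qed

section \<open>The model structures\<close>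

lemma X61I:
  assumes "\<And>X. A *v (A *v X) = - X"
    and "\<And>X Y. br61 (A *v X) (A *v Y) - br61 X Y - A *v (br61 (A *v X) Y) - A *v (br61 X (A *v Y)) = 0"
  shows "A \<in> X61"
  using assms by (simp add: X61_def complex_structure_def)

lemma J61_diag_in_X61: "J61_diag \<in> X61"
  by (rule X61I)
    (simp_all add: vec6_eq_iff matrix_vector_mult_def sum_6 J61_diag_def vector_6 algebra_simps)

lemma J61_in_X61: "\<alpha> \<noteq> 0 \<Longrightarrow> J61 \<alpha> \<in> X61"
  by (rule X61I)
    (simp_all add: vec6_eq_iff matrix_vector_mult_def sum_6 J61_def vector_6 field_simps)

lemma J61''_in_X61: "J61'' \<gamma> \<in> X61"
  by (rule X61I)
    (simp_all add: vec6_eq_iff matrix_vector_mult_def sum_6 J61''_def vector_6 algebra_simps)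

section \<open>Classification up to equivalence\<close>

context cs61
begin

section \<open>Integrability in coordinates and on the abelian ideal W\<close>

lemma integrable': "br61 (J X) (J Y) - br61 X Y = J (br61 (J X) Y + br61 X (J Y))"
  using integrable[of X Y] by (simp add: matrix_vector_right_distrib algebra_simps)

lemma integrable_nth:
  "br61 (J X) (J Y) $ 5 - br61 X Y $ 5 =
     a * (br61 (J X) Y + br61 X (J Y)) $ 5 + b * (br61 (J X) Y + br61 X (J Y)) $ 6"
  "br61 (J X) (J Y) $ 6 - br61 X Y $ 6 =
     c * (br61 (J X) Y + br61 X (J Y)) $ 5 - a * (br61 (J X) Y + br61 X (J Y)) $ 6"
proof -
  have Z: "br61 (J X) Y + br61 X (J Y) \<in> centre61"
    by (simp add: centre61_def)
  show "br61 (J X) (J Y) $ 5 - br61 X Y $ 5 =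
     a * (br61 (J X) Y + br61 X (J Y)) $ 5 + b * (br61 (J X) Y + br61 X (J Y)) $ 6"
    "br61 (J X) (J Y) $ 6 - br61 X Y $ 6 =
     c * (br61 (J X) Y + br61 X (J Y)) $ 5 - a * (br61 (J X) Y + br61 X (J Y)) $ 6"
    unfolding vector_minus_component[symmetric] integrable' J_on_centre[OF Z]
    by (simp_all add: axis_def)
qed

text \<open>W is abelian and its brackets lie in the line of \<open>x\<^sub>6\<close>, so the right
  side of integrability is \<open>J x\<^sub>6\<close> times the antisymmetric part of the form M(u,
  v), the sixth entry of [u, Jv].\<close>

lemma integrable_ideal:
  assumes "u$1 = 0" "u$2 = 0" "v$1 = 0" "v$2 = 0"
  shows "br61 (J u) (J v) $ 5 = b * (br61 u (J v) $ 6 - br61 v (J u) $ 6)"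
    "br61 (J u) (J v) $ 6 = - a * (br61 u (J v) $ 6 - br61 v (J u) $ 6)"
proof -
  have "(br61 (J u) v + br61 u (J v)) $ 5 = 0" "br61 u v = 0"
    by (simp_all add: vec6_eq_iff assms)
  moreover have "(br61 (J u) v + br61 u (J v)) $ 6 = br61 u (J v) $ 6 - br61 v (J u) $ 6"
    by (simp add: assms algebra_simps)
  ultimately show "br61 (J u) (J v) $ 5 = b * (br61 u (J v) $ 6 - br61 v (J u) $ 6)"
    "br61 (J u) (J v) $ 6 = - a * (br61 u (J v) $ 6 - br61 v (J u) $ 6)"
    using integrable_nth[of u v] by (simp_all del: br61_nth)
qed

text \<open>Here \<open>u\<close>, \<open>v\<close> are the images of \<open>x\<^sub>3\<close>, \<open>x\<^sub>4\<close>; they determine the images of \<open>x\<^sub>1\<close>, \<open>x\<^sub>2\<close>.\<close>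

lemma equiv61_J61I:
  assumes uv: "u$1 = 0" "u$2 = 0" "v$1 = 0" "v$2 = 0"
    and M: "br61 u (J u) $ 6 = m" "br61 u (J v) $ 6 = \<alpha> * m"
      "br61 v (J u) $ 6 = 0" "br61 v (J v) $ 6 = - (\<alpha> * m)"
    and nz: "m \<noteq> 0" "\<alpha> \<noteq> 0"
  shows "equiv61 A (J61 \<alpha>)"
proof -
  have D: "(J u)$1 * (J v)$2 - (J u)$2 * (J v)$1 = b * (\<alpha> * m)"
    "(J u)$1 * (J v)$4 - (J u)$4 * (J v)$1 + (J u)$2 * (J v)$3 - (J u)$3 * (J v)$2 = - a * (\<alpha> * m)"
    using integrable_ideal[OF uv] unfolding M by (simp_all)
  \<comment> \<open>Columns 3 and 4 of \<open>J61 \<alpha>\<close> solved for the images of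
    \<open>x\<^sub>2\<close> and \<open>x\<^sub>1\<close>; \<open>y5\<close> and \<open>y6\<close>
    are then forced as brackets.\<close>
  define y1 where "y1 = J u + u - (1/\<alpha>) *\<^sub>R J v"
  define y2 where "y2 = J u - \<alpha> *\<^sub>R u + v"
  define y5 :: "real^6" where "y5 = (b * m) *\<^sub>R axis 5 1 - (a * m) *\<^sub>R axis 6 (1::real)"
  define y6 :: "real^6" where "y6 = - m *\<^sub>R axis 6 (1::real)"
  define y where "y i = (vector [y1, y2, u, v, y5, y6] :: real^6^6) $ i" for i
  have [simp]: "y 1 = y1" "y 2 = y2" "y 3 = u" "y 4 = v" "y 5 = y5" "y 6 = y6"
    by (simp_all add: y_def vector_6)
  have z: "y5 \<in> centre61" "y6 \<in> centre61"
    by (simp_all add: y5_def y6_def centre61_def axis_def)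
  show ?thesis
  proof (rule equiv61I[where y = y])
    have "y1$1 * y2$2 - y1$2 * y2$1 = ((J u)$1 * (J v)$2 - (J u)$2 * (J v)$1) / \<alpha>"
      using nz by (simp add: y1_def y2_def uv field_simps)
    then have 5: "y1$1 * y2$2 - y1$2 * y2$1 = b * m"
      using D(1) nz by simp
    have "y1$1 * y2$4 - y1$4 * y2$1 + y1$2 * y2$3 - y1$3 * y2$2 =
      ((J u)$1 * (J v)$4 - (J u)$4 * (J v)$1 + (J u)$2 * (J v)$3 - (J u)$3 * (J v)$2) / \<alpha>
      + (1 + \<alpha>) * br61 u (J u) $ 6 - br61 v (J u) $ 6 - br61 u (J v) $ 6 + br61 v (J v) $ 6 / \<alpha>"
      using nz by (simp add: y1_def y2_def uv field_simps)
    also have "\<dots> = - a * m"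
      unfolding D(2) M using nz by (simp add: field_simps)
    finally have "y1$1 * y2$4 - y1$4 * y2$1 + y1$2 * y2$3 - y1$3 * y2$2 = - a * m" .
    then show "br61 (y 1) (y 2) = y 5"
      using 5 by (simp add: vec6_eq_iff y5_def axis_def)
    have "br61 y1 v $ 6 = br61 v (J v) $ 6 / \<alpha> - br61 v (J u) $ 6"
      using nz by (simp add: y1_def uv field_simps)
    then show "br61 (y 1) (y 4) = y 6"
      unfolding M using nz by (simp add: vec6_eq_iff y6_def axis_def y1_def uv)
    have "br61 y2 u $ 6 = - br61 u (J u) $ 6"
      by (simp add: y2_def uv algebra_simps)
    then show "br61 (y 2) (y 3) = y 6"
      unfolding M by (simp add: vec6_eq_iff y6_def axis_def y2_def uv)
    have "br61 y1 u $ 6 = br61 u (J v) $ 6 / \<alpha> - br61 u (J u) $ 6"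
      using nz by (simp add: y1_def uv field_simps)
    then show "br61 (y 1) (y 3) = 0"
      unfolding M using nz by (simp add: vec6_eq_iff axis_def y1_def uv)
    have "br61 y2 v $ 6 = - br61 v (J u) $ 6"
      by (simp add: y2_def uv algebra_simps)
    then show "br61 (y 2) (y 4) = 0"
      unfolding M by (simp add: vec6_eq_iff axis_def y2_def uv)
    show "br61 (y 3) (y 4) = 0"
      by (simp add: vec6_eq_iff uv)
    show "y 5 $ 5 * y 6 $ 6 - y 5 $ 6 * y 6 $ 5 \<noteq> 0"
      using nz centre_block by (simp add: y5_def y6_def axis_def)
    have c: "c * (b * m) = - m - a * (a * m)"
      using centre_block(1) by algebra
    have "A *v y1 = y2 + (\<alpha> - 1) *\<^sub>R u - ((\<alpha> - 1) / \<alpha>) *\<^sub>R v"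
      using nz by (simp add: y1_def y2_def matrix_vector_right_distrib matrix_vector_mult_diff_distrib
          matrix_vector_mult_scaleR vec_eq_iff field_simps)
    moreover have "A *v y2 = - \<alpha> *\<^sub>R y1 + (\<alpha> - 1) *\<^sub>R u"
      using nz by (simp add: y1_def y2_def matrix_vector_right_distrib matrix_vector_mult_diff_distrib
          matrix_vector_mult_scaleR vec_eq_iff field_simps)
    moreover have "A *v u = y2 + \<alpha> *\<^sub>R u - v"
      by (simp add: y2_def)
    moreover have "A *v v = - \<alpha> *\<^sub>R y1 + \<alpha> *\<^sub>R y2 + ((\<alpha> + 1) * \<alpha>) *\<^sub>R u - \<alpha> *\<^sub>R v"
      using nz by (simp add: y1_def y2_def vec_eq_iff field_simps)
    moreover have "A *v y5 = y6" "A *v y6 = - y5"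
      using c unfolding J_on_centre[OF z(1)] J_on_centre[OF z(2)]
      by (simp_all add: y5_def y6_def vec6_eq_iff axis_def)
    ultimately have "\<forall>j. A *v y j = (\<Sum>k\<in>UNIV. J61 \<alpha> $ k $ j *\<^sub>R y k)"
      unfolding forall_6 sum_6 J61_def vector_6 by simp
    then show "\<And>j. A *v y j = (\<Sum>k\<in>UNIV. J61 \<alpha> $ k $ j *\<^sub>R y k)" by blast
  qed (use z in simp_all)
qed

text \<open>Columns 3 and 4 of \<open>J61'' 0\<close> force \<open>J u\<close> and
  \<open>- J v\<close> as images of \<open>x\<^sub>1\<close>, \<open>x\<^sub>2\<close>. The entry 2
  on the centre arises because M(u, v) - M(v, u) is \<open>2 * m\<close>.\<close>

lemma equiv61_J61''I:
  assumes uv: "u$1 = 0" "u$2 = 0" "v$1 = 0" "v$2 = 0"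
    and M: "br61 u (J u) $ 6 = 0" "br61 u (J v) $ 6 = m"
      "br61 v (J u) $ 6 = - m" "br61 v (J v) $ 6 = 0"
    and nz: "m \<noteq> 0"
  shows "equiv61 A (J61'' 0)"
proof -
  note M' = M[simplified, unfolded uv, simplified]
  have D: "(J u)$1 * (J v)$2 - (J u)$2 * (J v)$1 = 2 * b * m"
    "(J u)$1 * (J v)$4 - (J u)$4 * (J v)$1 + (J u)$2 * (J v)$3 - (J u)$3 * (J v)$2 = - 2 * a * m"
    using integrable_ideal[OF uv] unfolding M by (simp_all)
  define y5 :: "real^6" where "y5 = (- 2 * b * m) *\<^sub>R axis 5 1 + (2 * a * m) *\<^sub>R axis 6 (1::real)"
  define y6 :: "real^6" where "y6 = m *\<^sub>R axis 6 (1::real)"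
  define y where "y i = (vector [J u, - J v, u, v, y5, y6] :: real^6^6) $ i" for i
  have [simp]: "y 1 = J u" "y 2 = - J v" "y 3 = u" "y 4 = v" "y 5 = y5" "y 6 = y6"
    by (simp_all add: y_def vector_6)
  have z: "y5 \<in> centre61" "y6 \<in> centre61"
    by (simp_all add: y5_def y6_def centre61_def axis_def)
  show ?thesis
  proof (rule equiv61I[where y = y])
    show "br61 (y 1) (y 2) = y 5"
      using D by (simp add: vec6_eq_iff y5_def axis_def)
    show "br61 (y 1) (y 4) = y 6" "br61 (y 2) (y 3) = y 6" "br61 (y 1) (y 3) = 0"
      "br61 (y 2) (y 4) = 0" "br61 (y 3) (y 4) = 0"
      using M' by (simp_all add: vec6_eq_iff y6_def axis_def uv algebra_simps)
    show "y 5 $ 5 * y 6 $ 6 - y 5 $ 6 * y 6 $ 5 \<noteq> 0"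
      using nz centre_block by (simp add: y5_def y6_def axis_def)
    have c: "c * (b * m) = - m - a * (a * m)"
      using centre_block(1) by algebra
    have "A *v y5 = 2 *\<^sub>R y6" "A *v y6 = - (1/2) *\<^sub>R y5"
      using c unfolding J_on_centre[OF z(1)] J_on_centre[OF z(2)]
      by (simp_all add: y5_def y6_def vec6_eq_iff axis_def)
    then have "\<forall>j. A *v y j = (\<Sum>k\<in>UNIV. J61'' 0 $ k $ j *\<^sub>R y k)"
      unfolding forall_6 sum_6 J61''_def vector_6 by (simp add: J_minus)
    then show "\<And>j. A *v y j = (\<Sum>k\<in>UNIV. J61'' 0 $ k $ j *\<^sub>R y k)" by blast
  qed (use z in simp_all)
qed

text \<open>J induces a complex structure on the plane g/W, of trace 0 and determinant 1, which
  preserves the area form giving the fifth entry of the bracket. The fifth entry of integrability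
  then leaves \<open>b\<close> times the sixth entry of [JX, Y] + [X, JY].\<close>

lemma abelianI:
  assumes W: "A$1$3 = 0" "A$1$4 = 0" "A$2$3 = 0" "A$2$4 = 0"
  shows "br61 (J X) (J Y) = br61 X Y"
proof -
  have s11: "A$1$1 * A$1$1 + A$1$2 * A$2$1 = -1" and s12: "A$1$1 * A$1$2 + A$1$2 * A$2$2 = 0"
    using square_entry[of 1 1] square_entry[of 1 2] by (simp_all add: sum_6 W)
  have "A$1$2 \<noteq> 0"
    using s11 by (metis add_0_right mult_zero_left not_square_less_zero less_minus_one_simps(1))
  moreover have "A$1$2 * (A$1$1 + A$2$2) = 0" using s12 by (simp add: algebra_simps)
  ultimately have tr: "A$2$2 = - A$1$1" by simp
  have J12: "(J X)$1 = A$1$1 * X$1 + A$1$2 * X$2" "(J X)$2 = A$2$1 * X$1 - A$1$1 * X$2" for X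
    by (simp_all add: matrix_vector_mult_def sum_6 W tr)
  define E where "E = br61 (J X) Y + br61 X (J Y)"
  have E5: "E $ 5 = 0" by (simp add: E_def J12 algebra_simps)
  have D5: "br61 (J X) (J Y) $ 5 - br61 X Y $ 5 = 0"
    unfolding br61_nth J12 using s11 by algebra
  have "E $ 6 = 0"
    using integrable_nth(1)[of X Y, folded E_def] D5 E5 centre_block(2) by simp
  then have "E = 0" using E5 by (simp add: vec6_eq_iff E_def)
  then have "br61 (J X) (J Y) - br61 X Y = 0"
    using integrable'[of X Y, folded E_def] by simp
  then show ?thesis by simp
qed

text \<open>With J abelian, choosing \<open>J y2, y2, y3, J y3\<close> halves the relations: it
  remains to have [Jy2, y3] = 0 and to normalise [Jy2, Jy3] and [Jy2, y2].\<close>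

lemma equiv61_J61_diagI:
  assumes W: "A$1$3 = 0" "A$1$4 = 0" "A$2$3 = 0" "A$2$4 = 0"
  shows "equiv61 A J61_diag"
proof -
  note ab = abelianI[OF W]
  \<comment> \<open>\<open>P\<close> and \<open>Q\<close> are the sixth entries of
    \<open>[J x\<^sub>1, x\<^sub>3]\<close> and \<open>[J x\<^sub>1, J x\<^sub>3]\<close>; they fix
    the direction of \<open>y3\<close>.\<close>
  define P where "P = A$2$1"
  define Q where "Q = A$1$1 * A$4$3 + A$2$1 * A$3$3"
  have "A$1$1 * A$1$1 + A$1$2 * A$2$1 = -1"
    using square_entry[of 1 1] by (simp add: sum_6 W)
  then have P: "P \<noteq> 0"
    unfolding P_def by (metis add_0_right mult_zero_right not_square_less_zero less_minus_one_simps(1))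
  have b: "b \<noteq> 0" by (rule centre_block)
  have PQ: "P * P + Q * Q > 0" using P by (simp add: sum_squares_gt_zero_iff)
  \<comment> \<open>\<kappa> scales \<open>y3\<close> so that [Jy2, Jy3] is \<open>y6\<close>;
    \<sigma> shifts the sixth entry of [Jy2, y2] to \<open>a * P / b\<close>, so that J sends this
    bracket to \<open>y6\<close>.\<close>
  define \<kappa> where "\<kappa> = P / b / (P * P + Q * Q)"
  define \<sigma> where "\<sigma> = (a * P / b + A$4$1) / (2 * P)"
  define x1 :: "real^6" where "x1 = axis 1 1"
  define x3 :: "real^6" where "x3 = axis 3 1"
  have Jx1: "(J x1)$i = A$i$1" and Jx3: "(J x3)$i = A$i$3" for i
    by (simp_all add: x1_def x3_def matrix_vector_mult_basis column_def)
  have x: "x1$1 = 1" "x1$2 = 0" "x1$3 = 0" "x1$4 = 0" "x3$1 = 0" "x3$2 = 0" "x3$3 = 1" "x3$4 = 0"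
    by (simp_all add: x1_def x3_def axis_def)
  define y2 where "y2 = x1 + \<sigma> *\<^sub>R x3"
  define y3 where "y3 = (\<kappa> * Q) *\<^sub>R x3 - (\<kappa> * P) *\<^sub>R J x3"
  define y5 :: "real^6" where "y5 = - P *\<^sub>R axis 5 1 + (a * P / b) *\<^sub>R axis 6 (1::real)"
  define y6 :: "real^6" where "y6 = (P / b) *\<^sub>R axis 6 (1::real)"
  have Jy2: "J y2 = J x1 + \<sigma> *\<^sub>R J x3"
    by (simp add: y2_def matrix_vector_right_distrib matrix_vector_mult_scaleR)
  have Jy3: "J y3 = (\<kappa> * Q) *\<^sub>R J x3 + (\<kappa> * P) *\<^sub>R x3"
    by (simp add: y3_def matrix_vector_mult_diff_distrib matrix_vector_mult_scaleR)
  define y where "y i = (vector [J y2, y2, y3, J y3, y5, y6] :: real^6^6) $ i" for i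
  have [simp]: "y 1 = J y2" "y 2 = y2" "y 3 = y3" "y 4 = J y3" "y 5 = y5" "y 6 = y6"
    by (simp_all add: y_def vector_6)
  have z: "y5 \<in> centre61" "y6 \<in> centre61"
    by (simp_all add: y5_def y6_def centre61_def axis_def)
  have "br61 (J y2) (J y3) $ 6 = \<kappa> * (P * P + Q * Q)"
    by (simp add: Jy2 Jy3 Jx1 Jx3 x W P_def Q_def algebra_simps)
  also have "\<dots> = P / b" using PQ by (simp add: \<kappa>_def)
  finally have 14: "br61 (J y2) (J y3) = y6"
    by (simp add: vec6_eq_iff y6_def axis_def Jy2 Jy3 Jx1 Jx3 x W)
  have "br61 (J y2) y3 $ 6 = 0"
    by (simp add: Jy2 y3_def Jx1 Jx3 x W P_def Q_def algebra_simps)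
  then have 13: "br61 (J y2) y3 = 0"
    by (simp add: vec6_eq_iff Jy2 y3_def Jx1 Jx3 x W)
  \<comment> \<open>Abelianness ties column 3 to column 1, which makes the coefficient of \<sigma>
    equal to \<open>2 * P\<close>.\<close>
  have "br61 (J (J x3)) (J x1) $ 6 = br61 (J x3) x1 $ 6"
    unfolding ab ..
  then have s: "A$4$3 = - A$2$1" by (simp add: Jx1 Jx3 x W)
  have "br61 (J y2) y2 $ 6 = - A$4$1 + 2 * P * \<sigma>"
    unfolding Jy2 by (simp add: y2_def Jx1 Jx3 x W s P_def)
  also have "\<dots> = a * P / b" using P by (simp add: \<sigma>_def)
  finally have 12: "br61 (J y2) y2 = y5"
    unfolding Jy2 by (simp add: vec6_eq_iff y5_def axis_def y2_def Jx1 Jx3 x W P_def)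
  show ?thesis
  proof (rule equiv61I[where y = y])
    show "br61 (y 1) (y 2) = y 5" "br61 (y 1) (y 4) = y 6" "br61 (y 1) (y 3) = 0"
      using 12 13 14 by simp_all
    show "br61 (y 2) (y 3) = y 6"
      using 14 ab by simp
    show "br61 (y 2) (y 4) = 0"
      using 13 ab[of y2 "J y3"] by (simp add: br61_minus_right)
    show "br61 (y 3) (y 4) = 0"
      unfolding \<open>y 3 = y3\<close> \<open>y 4 = J y3\<close> Jy3 by (simp add: vec6_eq_iff y3_def Jx3 x W)
    show "y 5 $ 5 * y 6 $ 6 - y 5 $ 6 * y 6 $ 5 \<noteq> 0"
      using P b by (simp add: y5_def y6_def axis_def)
    have "- (c * P) - a * (a * P / b) = - ((a * a + b * c) * P) / b"
      using b by (simp add: field_simps)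
    then have c: "- (c * P) - a * (a * P / b) = P / b"
      by (simp only: centre_block(1))
    have "A *v y5 = y6" "A *v y6 = - y5"
      using c b unfolding J_on_centre[OF z(1)] J_on_centre[OF z(2)]
      by (simp_all add: y5_def y6_def vec6_eq_iff axis_def)
    then have "\<forall>j. A *v y j = (\<Sum>k\<in>UNIV. J61_diag $ k $ j *\<^sub>R y k)"
      unfolding forall_6 sum_6 J61_diag_def vector_6 by simp
    then show "\<And>j. A *v y j = (\<Sum>k\<in>UNIV. J61_diag $ k $ j *\<^sub>R y k)" by blast
  qed (use z in simp_all)
qed

text \<open>W modulo the centre is a real plane. A singular corner block puts some nonzero
  \<open>w\<close> and \<open>J w\<close> both in it; they span it, so J preserves W.\<close>

lemma W_invariantI:
  assumes d: "A$1$3 * A$2$4 = A$1$4 * A$2$3"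
  shows "A$1$3 = 0 \<and> A$1$4 = 0 \<and> A$2$3 = 0 \<and> A$2$4 = 0"
proof (rule ccontr)
  assume nz: "\<not> ?thesis"
  obtain k3 k4 where k: "A$1$3 * k3 + A$1$4 * k4 = 0" "A$2$3 * k3 + A$2$4 * k4 = 0"
    and k0: "k3 \<noteq> 0 \<or> k4 \<noteq> 0"
  proof (cases "A$2$3 = 0 \<and> A$2$4 = 0")
    case True
    then show ?thesis using that[of "A$1$4" "- A$1$3"] nz by auto
  next
    case False
    then show ?thesis using that[of "A$2$4" "- A$2$3"] d by auto
  qed
  define w :: "real^6" where "w = k3 *\<^sub>R axis 3 1 + k4 *\<^sub>R axis 4 1"
  have w: "w$1 = 0" "w$2 = 0" "w$3 = k3" "w$4 = k4" "w$5 = 0" "w$6 = 0"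
    by (simp_all add: w_def axis_def)
  define h3 where "h3 = (J w)$3"
  define h4 where "h4 = (J w)$4"
  have Jw: "(J w)$1 = 0" "(J w)$2 = 0"
    using k by (simp_all add: matrix_vector_mult_def sum_6 w)
  have h: "h3 = A$3$3 * k3 + A$3$4 * k4" "h4 = A$4$3 * k3 + A$4$4 * k4"
    by (simp_all add: h3_def h4_def matrix_vector_mult_def sum_6 w)
  have JJ: "(J (J w))$i = A$i$3 * h3 + A$i$4 * h4" if "i \<in> {1,2,3,4}" for i
    unfolding matrix_vector_mult_def[of A "J w"] using that by (auto simp: sum_6 Jw h3_def h4_def)
  have JJ': "A$1$3 * h3 + A$1$4 * h4 = 0" "A$2$3 * h3 + A$2$4 * h4 = 0"
    "A$3$3 * h3 + A$3$4 * h4 = - k3" "A$4$3 * h3 + A$4$4 * h4 = - k4"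
    using JJ[of 1] JJ[of 2] JJ[of 3] JJ[of 4] by (simp_all add: w)
  \<comment> \<open>Proportional pairs would make \<open>w\<close> a real eigenvector modulo the
    centre; independent ones are two kernel vectors of the corner block, which must then
    vanish.\<close>
  show False
  proof (cases "k3 * h4 = k4 * h3")
    case True
    then have "h3 * h3 + k3 * k3 = 0" "h4 * h4 + k4 * k4 = 0"
      using h JJ'(3,4) by algebra+
    then show False using k0 by (simp add: sum_squares_eq_zero_iff)
  next
    case False
    then have e: "k3 * h4 - k4 * h3 \<noteq> 0" by simp
    have "A$1$3 * (k3 * h4 - k4 * h3) = 0" "A$1$4 * (k3 * h4 - k4 * h3) = 0"
      "A$2$3 * (k3 * h4 - k4 * h3) = 0" "A$2$4 * (k3 * h4 - k4 * h3) = 0"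
      using k JJ'(1,2) by algebra+
    then show False using e nz by simp
  qed
qed

theorem classification:
  "equiv61 A J61_diag \<or> (\<exists>\<alpha>. \<alpha> \<noteq> 0 \<and> equiv61 A (J61 \<alpha>)) \<or> equiv61 A (J61'' 0)"
proof (cases "A$1$3 * A$2$4 = A$1$4 * A$2$3")
  case True
  then show ?thesis using W_invariantI equiv61_J61_diagI by blast
next
  case False
  define \<delta> where "\<delta> = A$1$3 * A$2$4 - A$1$4 * A$2$3"
  have \<delta>: "\<delta> \<noteq> 0" using False by (simp add: \<delta>_def)
  have Jw: "(J w)$1 = A$1$3 * w$3 + A$1$4 * w$4" "(J w)$2 = A$2$3 * w$3 + A$2$4 * w$4"
    if "w$1 = 0" "w$2 = 0" for w
    using that by (simp_all add: matrix_vector_mult_def sum_6)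
  \<comment> \<open>The antisymmetric part of M is \<delta> / \<open>b\<close> times the area form
    on W modulo the centre, hence nonzero.\<close>
  have bE: "\<delta> * (u$3 * v$4 - u$4 * v$3) = b * (br61 u (J v) $ 6 - br61 v (J u) $ 6)"
    if "u$1 = 0" "u$2 = 0" "v$1 = 0" "v$2 = 0" for u v
  proof -
    have "\<delta> * (u$3 * v$4 - u$4 * v$3) = br61 (J u) (J v) $ 5"
      unfolding \<delta>_def by (simp add: Jw that) algebra
    also have "\<dots> = b * (br61 u (J v) $ 6 - br61 v (J u) $ 6)"
      using integrable_ideal(1)[OF that] .
    finally show ?thesis .
  qed
  show ?thesis
  proof (cases "\<exists>u. u$1 = 0 \<and> u$2 = 0 \<and> br61 u (J u) $ 6 \<noteq> 0")
    case True
    then obtain u where u: "u$1 = 0" "u$2 = 0" and m: "br61 u (J u) $ 6 \<noteq> 0" by blast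
    define m where "m = br61 u (J u) $ 6"
    define h1 where "h1 = (J u)$1"
    define h2 where "h2 = (J u)$2"
    \<comment> \<open>Chosen so that M(v, u) = 0.\<close>
    define v :: "real^6" where "v = h1 *\<^sub>R axis 3 1 - h2 *\<^sub>R axis 4 1"
    have v: "v$1 = 0" "v$2 = 0" "v$3 = h1" "v$4 = - h2"
      by (simp_all add: v_def axis_def)
    define m12 where "m12 = br61 u (J v) $ 6"
    define m22 where "m22 = br61 v (J v) $ 6"
    have m_eq: "m = - (u$3 * h2 + u$4 * h1)" by (simp add: m_def u h1_def h2_def)
    have m21: "br61 v (J u) $ 6 = 0" by (simp add: v h1_def h2_def)
    have dm: "\<delta> * m = b * m12"
      using bE[OF u v(1,2)] unfolding m21 m12_def[symmetric] by (simp add: v m_eq)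
    then have m12: "m12 \<noteq> 0" using m \<delta> by (auto simp: m_def)
    \<comment> \<open>\<open>m22 = 0\<close> would make \<open>J u\<close> and \<open>J v\<close>
      parallel modulo W, against the fifth entry \<open>b * m12\<close> of their bracket.\<close>
    have m22: "m22 \<noteq> 0"
    proof
      assume "m22 = 0"
      then have e: "h1 * (J v)$2 - h2 * (J v)$1 = 0"
        by (simp add: m22_def v)
      have "br61 (J u) (J v) $ 5 = b * m12"
        unfolding integrable_ideal(1)[OF u v(1,2)] m21 m12_def by simp
      then show False using e m12 centre_block(2) by (simp add: h1_def h2_def)
    qed
    \<comment> \<open>This scaling of \<open>v\<close> makes the last diagonal entry the negative of
      the off-diagonal one, as in the matrix of \<open>J61\<close>.\<close>
    define t where "t = - m12 / m22"
    have "equiv61 A (J61 (t * m12 / m))"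
    proof (rule equiv61_J61I[where u = u and v = "t *\<^sub>R v" and m = m])
      show "br61 u (J (t *\<^sub>R v)) $ 6 = t * m12 / m * m"
        using m by (simp add: matrix_vector_mult_scaleR br61_scaleR_right m12_def m_def del: br61_nth)
      show "br61 (t *\<^sub>R v) (J u) $ 6 = 0"
        using m21 by (simp add: br61_scaleR_left del: br61_nth)
      have "br61 (t *\<^sub>R v) (J (t *\<^sub>R v)) $ 6 = t * (t * m22)"
        by (simp add: matrix_vector_mult_scaleR br61_scaleR_right br61_scaleR_left m22_def
            del: br61_nth)
      then show "br61 (t *\<^sub>R v) (J (t *\<^sub>R v)) $ 6 = - (t * m12 / m * m)"
        using m22 m by (simp add: m_def[symmetric] t_def del: br61_nth)
      show "t * m12 / m \<noteq> 0" using m12 m22 m by (simp add: t_def m_def del: br61_nth)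
    qed (use u v m in \<open>simp_all add: m_def del: br61_nth\<close>)
    moreover have "t * m12 / m \<noteq> 0" using m12 m22 m by (simp add: t_def m_def del: br61_nth)
    ultimately show ?thesis by blast
  next
    case False
    then have M0: "br61 u (J u) $ 6 = 0" if "u$1 = 0" "u$2 = 0" for u using that by blast
    define u :: "real^6" where "u = axis 3 1"
    define v :: "real^6" where "v = axis 4 1"
    have uv: "u$1 = 0" "u$2 = 0" "v$1 = 0" "v$2 = 0" "u$3 = 1" "u$4 = 0" "v$3 = 0" "v$4 = 1"
      by (simp_all add: u_def v_def axis_def)
    \<comment> \<open>Polarisation: M vanishes on the diagonal, so it is alternating.\<close>
    have "br61 (u + v) (J (u + v)) $ 6 = 0" by (rule M0) (simp_all add: uv)
    then have s: "br61 v (J u) $ 6 = - br61 u (J v) $ 6"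
      using M0[OF uv(1,2)] M0[OF uv(3,4)]
      by (simp add: matrix_vector_right_distrib br61_add_left br61_add_right del: br61_nth)
    have "\<delta> = b * (br61 u (J v) $ 6 - br61 v (J u) $ 6)"
      using bE[OF uv(1-4)] by (simp add: uv del: br61_nth)
    then have "br61 u (J v) $ 6 \<noteq> 0" using \<delta> s by (auto simp del: br61_nth)
    then have "equiv61 A (J61'' 0)"
      using equiv61_J61''I[OF uv(1-4) M0[OF uv(1,2)] refl s M0[OF uv(3,4)]] by blast
    then show ?thesis by blast
  qed
qed

end

theorem mainTheorem4:
  shows "smooth_submanifold 12 X61 \<and>
    J61_diag \<in> X61 \<and>
    (\<forall>\<alpha>. \<alpha> \<noteq> 0 \<longrightarrow> J61 \<alpha> \<in> X61) \<and>
    J61'' 0 \<in> X61 \<and> J61'' 1 \<in> X61 \<and>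
    (\<forall>A\<in>X61. equiv61 A J61_diag \<or> (\<exists>\<alpha>. \<alpha> \<noteq> 0 \<and> equiv61 A (J61 \<alpha>)) \<or>
       equiv61 A (J61'' 0) \<or> equiv61 A (J61'' 1))"
proof (intro conjI allI impI ballI)
  fix A assume "A \<in> X61"
  then interpret cs61 A by unfold_locales
  show "equiv61 A J61_diag \<or> (\<exists>\<alpha>. \<alpha> \<noteq> 0 \<and> equiv61 A (J61 \<alpha>)) \<or>
      equiv61 A (J61'' 0) \<or> equiv61 A (J61'' 1)"
    using classification by blast
qed (simp_all add: smooth_submanifold_X61 J61_diag_in_X61 J61_in_X61 J61''_in_X61)

end
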